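(* Consider the one-gap system ($N=1$) of the context, with constants $m,q$ satisfying $m\ne0$, $m^2\ne9q^2$, and its stationary flow $\frac{dF}{dx}=\{F,h_1\}$ on $\mathcal M$. Let $\hat L(\lambda)$ evolve along this flow within the set of points satisfying the genericity assumptions of the context, let $\lambda_1,\lambda_2,\lambda_3$ be the roots of $$\mathcal{B}(\lambda)= \big[L_{11}(\lambda) - L_{22}(\lambda) \big] L_{31}(\lambda)L_{32}(\lambda)- L_{12}(\lambda) L_{31}^2(\lambda) + L_{21}(\lambda) L_{32}^2(\lambda),$$ and let $w_k = L_{11}(\lambda_k) -L_{12}(\lambda_k) L_{31}(\lambda_k)/L_{32}(\lambda_k)$. Then $$\frac{d\lambda_k}{dx}=-\frac{\big[3w_k^2-I_2(\lambda_k)\big](\lambda_i-\lambda_j)}{\det\widehat W},\qquad \widehat W=\begin{pmatrix} w_1&\lambda_1&1\\ w_2&\lambda_2&1\\ w_3&\lambda_3&1\end{pmatrix},$$ for every cyclic permutation $(k,i,j)$ of $(1,2,3)$. Consequently, the sums of Abelian integrals on the spectral curve $w^3-wI_2(\lambda)-I_3(\lambda)=0$ $$\varphi_1=\sum_{k=1}^3\int_{\lambda_0}^{\lambda_k}\frac{d\lambda}{3w^2-I_2(\lambda)},\qquad \varphi_2=\sum_{k=1}^3\int_{\lambda_0}^{\lambda_k}\frac{\lambda\,d\lambda}{3w^2-I_2(\lambda)},\qquad \varphi_3=\sum_{k=1}^3\int_{\lambda_0}^{\lambda_k}\frac{w\,d\lambda}{3w^2-I_2(\lambda)}$$ satisfy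 $$\frac{d\varphi_1}{dx}=0,\qquad \frac{d\varphi_2}{dx}=0,\qquad \frac{d\varphi_3}{dx}=-1,$$ so that $\varphi_1=C_1$, $\varphi_2=C_2$, $\varphi_3=C_3-x$ with constants $C_1,C_2,C_3$.
   Context: Phase space for $N=1$. $\mathcal M$ is the space of $3\times3$ matrix polynomials $\hat L(\lambda)=\hat L^{(0)}+\lambda\hat L^{(1)}$ with entries $L_{ij}(\lambda)=L_{ij}^{(0)}+\lambda L_{ij}^{(1)}$, where $\hat L^{(0)}$ is an arbitrary traceless matrix (entries $L_{ij}^{(0)}$ are complex coordinates) and $$\hat L^{(1)}=\frac12\begin{pmatrix} q & \frac{m}{\sqrt2} & \frac{m}{\sqrt2}\\ \frac{m}{\sqrt2} & -\frac q2 & \frac{3q}{2}\\ \frac{m}{\sqrt2}&\frac{3q}{2}&-\frac q2\end{pmatrix}$$ is constant. The Lie-Poisson bracket is $\{L_{ij}^{(0)},L_{kl}^{(0)}\}=L_{kj}^{(0)}\delta_{il}-L_{il}^{(0)}\delta_{kj}$, extended as an antisymmetric biderivation. Integrals of motion. $I_2(\lambda)=\frac12\operatorname{Tr}\hat L^2(\lambda)=h_0+h_1\lambda+h_2\lambda^2$ and $I_3(\lambda)=\frac13\operatorname{Tr}\hat L^3(\lambda)=f_0+f_1\lambda+f_2\lambda^2+f_3\lambda^3$. All $h_k,f_k$ are in involution ($h_0,f_0$ are Casimir functions and $h_2,f_3$ are constants), hence constant along the flow, so the spectral curve $w^3-wI_2(\lambda)-I_3(\lambda)=0$, i.e. $\det(\hat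 L(\lambda)-w\mathbb I)=0$, does not change along the flow. Each $(w_k,\lambda_k)$ lies on this curve. Genericity assumptions. The cubic polynomial $\mathcal B$ (whose leading coefficient is a nonzero constant) has three pairwise distinct nonzero roots, $L_{31}(\lambda_k)\ne0$, $L_{32}(\lambda_k)\ne 0$ and $3w_k^2-I_2(\lambda_k)\neq0$ for $k=1,2,3$, and $\det\widehat W\ne0$. Integrals. The $k$-th integral in each $\varphi_j$ is taken along a path on the spectral curve (avoiding points where $3w^2-I_2(\lambda)=0$) from a fixed base point over $\lambda_0$ to the point $(w_k,\lambda_k)$; the path varies continuously with $x$. *)

theory Defs
  imports "HOL-Analysis.Analysis"
    "HOL-Computational_Algebra.Polynomial"
begin

no_notation fps_nth (infixl "$" 75)

type_synonym cmat = "complex^3^3"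

text \<open>A point of the phase space is its traceless matrix \<open>A\<close> of coordinates
  \<open>L\<^sup>(\<^sup>0\<^sup>)\<^sub>i\<^sub>j\<close>; the coefficient of \<open>\<lambda>\<close> is the fixed matrix \<open>L1 m q\<close>.\<close>

definition phase_space :: "cmat set" where
  "phase_space = {A. trace A = 0}"

definition L1 :: "complex \<Rightarrow> complex \<Rightarrow> cmat" where
  "L1 m q = (1/2) *\<^sub>R vector
     [vector [q, m / complex_of_real (sqrt 2), m / complex_of_real (sqrt 2)],
      vector [m / complex_of_real (sqrt 2), - q / 2, 3 * q / 2],
      vector [m / complex_of_real (sqrt 2), 3 * q / 2, - q / 2]]"

definition lax :: "complex \<Rightarrow> complex \<Rightarrow> cmat \<Rightarrow> complex poly^3^3" where
  "lax m q A = (\<chi> i j. [:A $ i $ j, L1 m q $ i $ j:])"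

definition I2 :: "complex \<Rightarrow> complex \<Rightarrow> cmat \<Rightarrow> complex poly" where
  "I2 m q A = smult (1/2) (trace (lax m q A ** lax m q A))"

definition I3 :: "complex \<Rightarrow> complex \<Rightarrow> cmat \<Rightarrow> complex poly" where
  "I3 m q A = smult (1/3) (trace (lax m q A ** lax m q A ** lax m q A))"

definition h_coeff :: "complex \<Rightarrow> complex \<Rightarrow> nat \<Rightarrow> cmat \<Rightarrow> complex" where
  "h_coeff m q k A = coeff (I2 m q A) k"

definition coord_deriv :: "3 \<Rightarrow> 3 \<Rightarrow> (cmat \<Rightarrow> complex) \<Rightarrow> cmat \<Rightarrow> complex" where
  "coord_deriv i j F A =
     deriv (\<lambda>z. F (\<chi> a b. if a = i \<and> b = j then z else A $ a $ b)) (A $ i $ j)"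

inductive_set observables :: "(cmat \<Rightarrow> complex) set" where
  const: "(\<lambda>A. c) \<in> observables"
| coord: "(\<lambda>A. A $ i $ j) \<in> observables"
| add: "F \<in> observables \<Longrightarrow> G \<in> observables \<Longrightarrow> (\<lambda>A. F A + G A) \<in> observables"
| mult: "F \<in> observables \<Longrightarrow> G \<in> observables \<Longrightarrow> (\<lambda>A. F A * G A) \<in> observables"

text \<open>The bracket is written on all \<open>3 \<times> 3\<close> matrices. The trace is a Casimir function
  there (\<open>poisson_trace\<close> below), so at points of \<open>phase_space\<close> the value depends only on
  the restrictions of the two observables to \<open>phase_space\<close>.\<close>

definition poisson :: "(cmat \<Rightarrow> complex) \<Rightarrow> (cmat \<Rightarrow> complex) \<Rightarrow> cmat \<Rightarrow> complex" where
  "poisson F G A = (\<Sum>i\<in>UNIV. \<Sum>j\<in>UNIV. \<Sum>k\<in>UNIV. \<Sum>l\<in>UNIV.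
     coord_deriv i j F A * coord_deriv k l G A *
     ((if i = l then A $ k $ j else 0) - (if k = j then A $ i $ l else 0)))"

lemma coord_deriv_coord: "coord_deriv i j (\<lambda>A. A $ k $ l) A = (if i = k \<and> j = l then 1 else 0)"
  by (auto simp: coord_deriv_def)

lemma observables_coord_differentiable:
  assumes "F \<in> observables"
  shows "(\<lambda>z. F (\<chi> a b. if a = i \<and> b = j then z else A $ a $ b)) field_differentiable at x"
  using assms
proof induction
  case (coord k l)
  then show ?case by (cases "k = i \<and> l = j") auto
qed (auto intro: field_differentiable_add field_differentiable_mult)

lemma coord_deriv_mult:
  assumes "F \<in> observables" "G \<in> observables"
  shows "coord_deriv i j (\<lambda>A. F A * G A) A = F A * coord_deriv i j G A + coord_deriv i j F A * G A"
proof -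
  have "(\<chi> a b. if a = i \<and> b = j then A $ i $ j else A $ a $ b) = A"
    by (auto simp: vec_eq_iff)
  then show ?thesis
    using assms by (simp add: coord_deriv_def observables_coord_differentiable)
qed

lemma coord_deriv_add:
  assumes "F \<in> observables" "G \<in> observables"
  shows "coord_deriv i j (\<lambda>A. F A + G A) A = coord_deriv i j F A + coord_deriv i j G A"
  using assms by (simp add: coord_deriv_def observables_coord_differentiable)

lemma poisson_coord:
  "poisson (\<lambda>A. A $ i $ j) (\<lambda>A. A $ k $ l) A =
     A $ k $ j * (if i = l then 1 else 0) - A $ i $ l * (if k = j then 1 else 0)"
proof -
  have *: "(\<Sum>a\<in>UNIV. \<Sum>b\<in>UNIV. (if a = i \<and> b = j then 1 else 0) * f a b) = f i j"
    for f :: "3 \<Rightarrow> 3 \<Rightarrow> complex" and i j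
    using exhaust_3 [of i] exhaust_3 [of j] by (auto simp: sum_3)
  show ?thesis
    unfolding poisson_def coord_deriv_coord
    by (simp only: mult.assoc sum_distrib_left [symmetric] *) simp
qed

lemma poisson_antisym: "poisson G F A = - poisson F G A"
proof -
  define c where "c i j k l = coord_deriv i j F A * coord_deriv k l G A *
     ((if i = l then A $ k $ j else 0) - (if k = j then A $ i $ l else 0))" for i j k l
  have c: "coord_deriv k l G A * coord_deriv i j F A *
     ((if k = j then A $ i $ l else 0) - (if i = l then A $ k $ j else 0)) = - c i j k l"
    for i j k l
    by (simp add: c_def right_diff_distrib mult.commute)
  have swap: "(\<Sum>k\<in>UNIV. \<Sum>l\<in>UNIV. \<Sum>i\<in>UNIV. \<Sum>j\<in>UNIV. f i j k l)
      = (\<Sum>i\<in>UNIV. \<Sum>j\<in>UNIV. \<Sum>k\<in>UNIV. \<Sum>l\<in>UNIV. f i j k l)"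
    for f :: "3 \<Rightarrow> 3 \<Rightarrow> 3 \<Rightarrow> 3 \<Rightarrow> complex"
    using sum.swap [of "\<lambda>p r. f (fst r) (snd r) (fst p) (snd p)" "UNIV \<times> UNIV" "UNIV \<times> UNIV"]
    by (simp only: sum.cartesian_product' fst_conv snd_conv)
  have "poisson G F A = (\<Sum>k\<in>UNIV. \<Sum>l\<in>UNIV. \<Sum>i\<in>UNIV. \<Sum>j\<in>UNIV. - c i j k l)"
    by (simp only: poisson_def c)
  also have "\<dots> = - (\<Sum>i\<in>UNIV. \<Sum>j\<in>UNIV. \<Sum>k\<in>UNIV. \<Sum>l\<in>UNIV. c i j k l)"
    by (subst swap) (simp only: sum_negf)
  finally show ?thesis
    by (simp only: poisson_def c_def)
qed

lemma poisson_add: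
  assumes "F \<in> observables" "G \<in> observables"
  shows "poisson (\<lambda>A. F A + G A) H A = poisson F H A + poisson G H A"
  by (simp add: poisson_def coord_deriv_add [OF assms] distrib_right sum.distrib)

lemma poisson_mult:
  assumes "F \<in> observables" "G \<in> observables"
  shows "poisson (\<lambda>A. F A * G A) H A = F A * poisson G H A + poisson F H A * G A"
  unfolding poisson_def coord_deriv_mult [OF assms] sum_distrib_left sum_distrib_right
    sum.distrib [symmetric]
  by (intro sum.cong refl) (simp only: distrib_right distrib_left mult.assoc mult.commute mult.left_commute)

lemma poisson_trace: "poisson trace F A = 0"
proof -
  have *: "coord_deriv i j trace A = (if i = j then 1 else 0)" for i j
  proof -
    have tr: "trace = (\<lambda>A::cmat. A $ 1 $ 1 + (A $ 2 $ 2 + A $ 3 $ 3))"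
      by (auto simp: trace_def sum_3)
    show ?thesis
      unfolding tr
      using exhaust_3 [of i] exhaust_3 [of j]
      by (simp only: coord_deriv_add observables.intros coord_deriv_coord) auto
  qed
  show ?thesis
    unfolding poisson_def * sum_3 by simp
qed

definition stationary_flow ::
  "complex \<Rightarrow> complex \<Rightarrow> real set \<Rightarrow> (real \<Rightarrow> cmat) \<Rightarrow> bool" where
  "stationary_flow m q T L \<longleftrightarrow>
     (\<forall>x\<in>T. L x \<in> phase_space \<and>
       (\<forall>F\<in>observables.
         ((\<lambda>y. F (L y)) has_vector_derivative poisson F (h_coeff m q 1) (L x)) (at x)))"

definition Bpoly :: "complex \<Rightarrow> complex \<Rightarrow> cmat \<Rightarrow> complex poly" where
  "Bpoly m q A = (let M = lax m q A in
     (M $ 1 $ 1 - M $ 2 $ 2) * (M $ 3 $ 1) * (M $ 3 $ 2)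
     - M $ 1 $ 2 * (M $ 3 $ 1)^2 + M $ 2 $ 1 * (M $ 3 $ 2)^2)"

definition wval :: "complex \<Rightarrow> complex \<Rightarrow> cmat \<Rightarrow> complex \<Rightarrow> complex" where
  "wval m q A z = (let M = lax m q A in
     poly (M $ 1 $ 1) z - poly (M $ 1 $ 2) z * poly (M $ 3 $ 1) z / poly (M $ 3 $ 2) z)"

definition What :: "complex \<Rightarrow> complex \<Rightarrow> cmat \<Rightarrow> (3 \<Rightarrow> complex) \<Rightarrow> cmat" where
  "What m q A r = (\<chi> k. vector [wval m q A (r k), r k, 1])"

definition spectral_curve :: "complex \<Rightarrow> complex \<Rightarrow> cmat \<Rightarrow> (complex \<times> complex) set" where
  "spectral_curve m q A =
     {(w, z). w^3 - w * poly (I2 m q A) z - poly (I3 m q A) z = 0}"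

text \<open>\<open>r\<close> is a labelling of the roots of \<open>Bpoly m q A\<close> by \<open>1, 2, 3\<close>.\<close>

definition generic ::
  "complex \<Rightarrow> complex \<Rightarrow> cmat \<Rightarrow> (3 \<Rightarrow> complex) \<Rightarrow> bool" where
  "generic m q A r \<longleftrightarrow>
     {z. poly (Bpoly m q A) z = 0} = range r \<and> inj r \<and>
     (\<forall>k. r k \<noteq> 0 \<and>
        poly (lax m q A $ 3 $ 1) (r k) \<noteq> 0 \<and>
        poly (lax m q A $ 3 $ 2) (r k) \<noteq> 0 \<and>
        3 * (wval m q A (r k))^2 - poly (I2 m q A) (r k) \<noteq> 0) \<and>
     det (What m q A r) \<noteq> 0"

text \<open>A family \<open>p x\<close>, \<open>x \<in> T\<close>, of integration paths \<open>[0,1] \<rightarrow> \<complex> \<times> \<complex>\<close>, \<open>t \<mapsto> (w, \<lambda>)\<close>,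
  from the base point \<open>b\<close> to the point of the curve over \<open>\<lambda> = l x\<close>. Away from
  \<open>3w\<^sup>2 = I\<^sub>2(\<lambda>)\<close>, \<open>\<lambda>\<close> is a local coordinate on the curve, so piecewise smoothness is
  required of the \<open>\<lambda>\<close>-component only.\<close>

definition path_family ::
  "complex \<Rightarrow> complex \<Rightarrow> real set \<Rightarrow> (real \<Rightarrow> cmat) \<Rightarrow> (real \<Rightarrow> complex) \<Rightarrow>
   complex \<times> complex \<Rightarrow> (real \<Rightarrow> real \<Rightarrow> complex \<times> complex) \<Rightarrow> bool" where
  "path_family m q T L l b p \<longleftrightarrow>
     continuous_on (T \<times> {0..1}) (\<lambda>(x, t). p x t) \<and>
     (\<forall>x\<in>T. valid_path (\<lambda>t. snd (p x t)) \<and>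
        p x 0 = b \<and> p x 1 = (wval m q (L x) (l x), l x) \<and>
        (\<forall>t\<in>{0..1}. p x t \<in> spectral_curve m q (L x) \<and>
           3 * (fst (p x t))^2 - poly (I2 m q (L x)) (snd (p x t)) \<noteq> 0))"

text \<open>The integral of \<open>g(w, \<lambda>) d\<lambda> / (3w\<^sup>2 - I\<^sub>2(\<lambda>))\<close> along \<open>p\<close>.\<close>

definition abelian_integral ::
  "complex \<Rightarrow> complex \<Rightarrow> cmat \<Rightarrow> (complex \<Rightarrow> complex \<Rightarrow> complex) \<Rightarrow>
   (real \<Rightarrow> complex \<times> complex) \<Rightarrow> complex" where
  "abelian_integral m q A g p = integral {0..1}
     (\<lambda>t. g (fst (p t)) (snd (p t)) / (3 * (fst (p t))^2 - poly (I2 m q A) (snd (p t)))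
          * vector_derivative (\<lambda>s. snd (p s)) (at t within {0..1}))"

definition abelian_sum ::
  "complex \<Rightarrow> complex \<Rightarrow> (real \<Rightarrow> cmat) \<Rightarrow> (complex \<Rightarrow> complex \<Rightarrow> complex) \<Rightarrow>
   (3 \<Rightarrow> real \<Rightarrow> real \<Rightarrow> complex \<times> complex) \<Rightarrow> real \<Rightarrow> complex" where
  "abelian_sum m q L g P x = (\<Sum>k\<in>UNIV. abelian_integral m q (L x) g (P k x))"

end

(*
  The flow is the Lax equation L' = [L1, L], so it preserves the spectral curve. At a root of B the
  vector (L32, -L31, 0) is an eigenvector of L(lambda_k) with eigenvalue w_k. The derivative of B along
  the flow at lambda_k is kappa (3 w_k^2 - I2(lambda_k)), where kappa = L1_31 L32 - L1_32 L31 is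
  independent of lambda; and kappa w_k is a quadratic polynomial in lambda_k with the same leading
  coefficient as B. Hence kappa det W is that coefficient times a Vandermonde determinant, and the
  equations for the roots follow from B = c (z - lambda_1) (z - lambda_2) (z - lambda_3).

  Away from 3 w^2 = I2 the curve is locally a graph over lambda, so the differential has local
  primitives there; near a fixed x the integral changes only by the change of a local primitive
  at the end point. The derivatives of the three sums are then identities for the rows of a determinant.
*)

theory Submission
  imports Defs "HOL-Complex_Analysis.Cauchy_Integral_Theorem"
begin

section \<open>Local branches of the spectral curve\<close>

text \<open>The second condition is the nonvanishing of the \<open>w\<close>-derivative of the
  cubic; at such points \<open>z\<close> is a local coordinate on the curve.\<close>

definition regular_curve :: "complex poly \<Rightarrow> complex poly \<Rightarrow> (complex \<times> complex) set" where
  "regular_curve P R =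
     {(w, z). w^3 - w * poly P z - poly R z = 0 \<and> 3 * w^2 - poly P z \<noteq> 0}"

text \<open>The map (\<open>w\<close>, \<open>z\<close>) to (cubic, \<open>z\<close>) has Jacobian
  \<open>3 * w^2 - poly P z\<close>, so the inverse function theorem straightens the curve to the
  slice with first coordinate 0. Injectivity on \<open>U\<close> excludes the other sheets.\<close>

lemma regular_curve_branch:
  assumes c0: "(w0, z0) \<in> regular_curve P R"
  obtains U W d where "open U" "(w0, z0) \<in> U" "d > 0" "W holomorphic_on ball z0 d" "W z0 = w0"
    "\<And>z. z \<in> ball z0 d \<Longrightarrow> (W z, z) \<in> regular_curve P R"
    "\<And>w z. (w, z) \<in> U \<Longrightarrow> (w, z) \<in> regular_curve P R \<Longrightarrow> z \<in> ball z0 d \<and> w = W z"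
proof -
  define f where "f = (\<lambda>(w, z). (w^3 - w * poly P z - poly R z, z))"
  \<comment> \<open>\<open>\<alpha>\<close> is the partial derivative of the cubic in
    \<open>w\<close> and \<open>- \<beta>\<close> the one in \<open>z\<close>, so \<open>D v\<close>
    is the derivative of \<open>f\<close> at \<open>v\<close>.\<close>
  define \<alpha> where "\<alpha> = (\<lambda>v. 3 * (fst v)^2 - poly P (snd v))"
  define \<beta> where "\<beta> = (\<lambda>v. fst v * poly (pderiv P) (snd v) + poly (pderiv R) (snd v))"
  define D where "D = (\<lambda>(v::complex\<times>complex) (h::complex\<times>complex). (\<alpha> v * fst h - \<beta> v * snd h, snd h))"
  define S where "S = {v. \<alpha> v \<noteq> 0}"
  have cont\<alpha>: "continuous_on UNIV \<alpha>" and cont\<beta>: "continuous_on UNIV \<beta>"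
    unfolding \<alpha>_def \<beta>_def by (intro continuous_intros)+
  have "open S"
    unfolding S_def using cont\<alpha> by (intro open_Collect_neq) auto
  have bl: "bounded_linear (D v)" for v
    unfolding D_def
    by (intro bounded_linear_intros)
  have dp: "((\<lambda>v. poly Q (snd v)) has_derivative (\<lambda>h. snd h * poly (pderiv Q) (snd v))) (at v)"
    for Q :: "complex poly" and v :: "complex \<times> complex"
    using has_derivative_compose[OF has_derivative_snd[OF has_derivative_ident]
        poly_DERIV[of Q "snd v", unfolded has_field_derivative_def]]
    by (simp add: mult.commute)
  have derf: "(f has_derivative blinfun_apply (Blinfun (D v))) (at v)" for v
  proof -
    have "((\<lambda>v. (fst v^3 - fst v * poly P (snd v) - poly R (snd v), snd v)) has_derivative D v) (at v)"
      unfolding D_def \<alpha>_def \<beta>_def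
      by (rule derivative_eq_intros dp refl)+
        (simp add: fun_eq_iff algebra_simps power2_eq_square)
    then show ?thesis
      by (simp add: f_def case_prod_unfold bounded_linear_Blinfun_apply[OF bl])
  qed
  have contD: "continuous_on S (\<lambda>v. Blinfun (D v))"
  proof (rule continuous_on_blinfun_componentwise)
    fix i :: "complex \<times> complex"
    have "continuous_on S (\<lambda>v. D v i)"
      unfolding D_def
      by (intro continuous_intros continuous_on_subset[OF cont\<alpha>] continuous_on_subset[OF cont\<beta>]) auto
    then show "continuous_on S (\<lambda>v. blinfun_apply (Blinfun (D v)) i)"
      by (simp only: bounded_linear_Blinfun_apply[OF bl])
  qed
  \<comment> \<open>\<open>D (w0, z0)\<close> is triangular; \<open>E\<close> is its inverse,
    obtained by back substitution.\<close>
  define E where "E = (\<lambda>h::complex\<times>complex. (inverse (\<alpha> (w0,z0)) * (fst h + \<beta> (w0,z0) * snd h), snd h))"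
  have blE: "bounded_linear E"
    unfolding E_def by (intro bounded_linear_intros)
  have v0: "(w0, z0) \<in> S"
    using c0 by (auto simp: S_def \<alpha>_def regular_curve_def)
  have "Blinfun E o\<^sub>L Blinfun (D (w0,z0)) = id_blinfun"
    using v0
    by (intro blinfun_eqI, unfold blinfun_apply_blinfun_compose bounded_linear_Blinfun_apply[OF bl]
        bounded_linear_Blinfun_apply[OF blE]) (simp add: E_def D_def S_def prod_eq_iff)
  then obtain U' V g g' where U': "open U'" "U' \<subseteq> S" "(w0, z0) \<in> U'" and V: "open V" "f (w0, z0) \<in> V"
    and hom: "homeomorphism U' V f g" and g: "\<And>y. y \<in> V \<Longrightarrow> (g has_derivative (g' y)) (at y)"
    and g': "\<And>y. y \<in> V \<Longrightarrow> g' y = inv (blinfun_apply (Blinfun (D (g y))))"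
    and bij: "\<And>y. y \<in> V \<Longrightarrow> bij (blinfun_apply (Blinfun (D (g y))))"
    using inverse_function_theorem[OF \<open>open S\<close> derf contD v0] by metis
  have fw0: "f (w0, z0) = (0, z0)"
    using c0 by (auto simp: f_def regular_curve_def)
  have "open ((\<lambda>z. (0::complex, z)) -` V)"
    using V(1) by (intro open_vimage continuous_intros)
  then obtain d where d: "d > 0" "ball z0 d \<subseteq> (\<lambda>z. (0, z)) -` V"
    using V(2) fw0 by (metis open_contains_ball_eq vimageI)
  \<comment> \<open>\<open>f\<close> keeps the second coordinate, so the local inverse
    \<open>g\<close> sends \<open>(0, z)\<close> to a point over \<open>z\<close>; its first
    coordinate is the branch.\<close>
  define W where "W = (\<lambda>z. fst (g (0, z)))"
  have gW: "g (0, z) = (W z, z)" "(W z, z) \<in> U'" "f (W z, z) = (0, z)" if "z \<in> ball z0 d" for z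
  proof -
    have "(0, z) \<in> V"
      using d that by auto
    then have *: "f (g (0, z)) = (0, z)" "g (0, z) \<in> U'"
      using hom by (auto simp: homeomorphism_def)
    then have "snd (g (0, z)) = z"
      by (auto simp: f_def case_prod_unfold)
    then show "g (0, z) = (W z, z)"
      by (metis W_def prod.collapse)
    with * show "(W z, z) \<in> U'" "f (W z, z) = (0, z)"
      by auto
  qed
  have hol: "W holomorphic_on ball z0 d"
  proof (rule holomorphic_onI)
    fix z assume z: "z \<in> ball z0 d"
    have zV: "(0, z) \<in> V"
      using d z by auto
    define a b where "a = \<alpha> (W z, z)" and "b = \<beta> (W z, z)"
    have "a \<noteq> 0"
      using gW(2)[OF z] U'(2) by (auto simp: S_def a_def)
    have "((\<lambda>z. (0::complex, z)) has_derivative (\<lambda>h. (0, h))) (at z)"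
      by (intro derivative_intros)
    then have "((\<lambda>z. g (0, z)) has_derivative (\<lambda>h. g' (0, z) (0, h))) (at z)"
      using g[OF zV] by (rule has_derivative_compose)
    then have dW: "(W has_derivative (\<lambda>h. fst (g' (0, z) (0, h)))) (at z)"
      unfolding W_def by (rule has_derivative_fst)
    \<comment> \<open>Implicit differentiation: \<open>a * h1 - b * h = 0\<close> gives
      \<open>h1 = b / a * h\<close>. The derivative of \<open>g\<close> is a priori only
      real-linear; being a complex multiplication makes \<open>W\<close> holomorphic.\<close>
    have "g' (0, z) (0, h) = (b / a * h, h)" for h
    proof -
      have "Blinfun (D (g (0,z))) (b / a * h, h) = (0, h)"
        unfolding bounded_linear_Blinfun_apply[OF bl] gW(1)[OF z]
        using \<open>a \<noteq> 0\<close> by (simp add: D_def flip: a_def b_def)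
      then show ?thesis
        unfolding g'[OF zV] using bij_inv_eq_iff[OF bij[OF zV]] by metis
    qed
    then have "(\<lambda>h. fst (g' (0, z) (0, h))) = (*) (b / a)"
      by auto
    with dW have "(W has_field_derivative (b / a)) (at z)"
      by (simp only: has_field_derivative_def)
    then show "W field_differentiable at z within ball z0 d"
      using field_differentiable_at_within field_differentiable_def by blast
  qed
  show thesis
  proof
    show "open (U' \<inter> UNIV \<times> ball z0 d)"
      using U' by (intro open_Int open_Times) auto
    show "(w0, z0) \<in> U' \<inter> UNIV \<times> ball z0 d"
      using U' d by auto
    have inv_f: "g (0, z) = (w, z)" if "(w, z) \<in> U'" "(w, z) \<in> regular_curve P R" for w z
    proof -
      have "f (w, z) = (0, z)"
        using that by (auto simp: f_def regular_curve_def)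
      then show ?thesis
        using hom that(1) by (metis homeomorphism_apply1)
    qed
    show "W z0 = w0"
      using inv_f[OF U'(3) c0] by (simp add: W_def)
    show "(W z, z) \<in> regular_curve P R" if "z \<in> ball z0 d" for z
      using gW[OF that] U' by (auto simp: regular_curve_def f_def S_def \<alpha>_def)
    show "z \<in> ball z0 d \<and> w = W z"
      if "(w, z) \<in> U' \<inter> UNIV \<times> ball z0 d" "(w, z) \<in> regular_curve P R" for w z
      using that inv_f by (auto simp: W_def)
  qed (use d hol in auto)
qed

section \<open>Integrals along moving paths on the curve\<close>

text \<open>\<open>F\<close> is a function of \<open>\<lambda>\<close> alone; the open set \<open>U\<close> selects a sheet of the curve.\<close>

definition local_primitive ::
  "complex poly \<Rightarrow> complex poly \<Rightarrow> (complex \<Rightarrow> complex \<Rightarrow> complex) \<Rightarrow>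
   (complex \<times> complex) set \<Rightarrow> (complex \<Rightarrow> complex) \<Rightarrow> bool" where
  "local_primitive P R g U F \<longleftrightarrow> open U \<and>
     (\<forall>(w, z) \<in> U \<inter> regular_curve P R.
        (F has_field_derivative g w z / (3 * w^2 - poly P z)) (at z))"

lemma isCont_tendsto_nhds: "isCont f x \<Longrightarrow> (f \<longlongrightarrow> f x) (nhds x)"
  unfolding isCont_def tendsto_at_iff_tendsto_nhds .

text \<open>Along the branch \<open>W\<close> the differential is a holomorphic function of
  \<open>z\<close> on a disc, and a disc is convex, so it has a primitive. The condition on
  \<open>g\<close> says just that substituting a holomorphic branch gives a holomorphic
  function.\<close>

lemma local_primitive_exists:
  assumes c: "c \<in> regular_curve P R"
    and g: "\<And>A W. open A \<Longrightarrow> W holomorphic_on A \<Longrightarrow> (\<lambda>z. g (W z) z) holomorphic_on A"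
  obtains U F where "local_primitive P R g U F" "c \<in> U"
proof -
  obtain w0 z0 where [simp]: "c = (w0, z0)"
    by fastforce
  have c0: "(w0, z0) \<in> regular_curve P R"
    using c by simp
  obtain U W d where *: "open U" "(w0, z0) \<in> U" "d > 0" "W holomorphic_on ball z0 d" "W z0 = w0"
    "\<And>z. z \<in> ball z0 d \<Longrightarrow> (W z, z) \<in> regular_curve P R"
    "\<And>w z. (w, z) \<in> U \<Longrightarrow> (w, z) \<in> regular_curve P R \<Longrightarrow> z \<in> ball z0 d \<and> w = W z"
    by (rule regular_curve_branch[OF c0]) blast
  have "(\<lambda>z. g (W z) z / (3 * (W z)^2 - poly P z)) holomorphic_on ball z0 d"
    using *(6) by (intro holomorphic_intros g *(4)) (auto simp: regular_curve_def)
  then obtain F where F: "\<And>z. z \<in> ball z0 d \<Longrightarrow>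
      (F has_field_derivative g (W z) z / (3 * (W z)^2 - poly P z)) (at z within ball z0 d)"
    using holomorphic_convex_primitive'[OF convex_ball open_ball] by blast
  have "local_primitive P R g U F"
    unfolding local_primitive_def
  proof (intro conjI ballI *(1), clarify)
    fix w z assume "(w, z) \<in> U" "(w, z) \<in> regular_curve P R"
    then have "z \<in> ball z0 d" "w = W z"
      using *(7) by auto
    then show "(F has_field_derivative g w z / (3 * w^2 - poly P z)) (at z)"
      using F[of z] by (simp add: at_within_open[OF _ open_ball])
  qed
  with *(2) show thesis
    using that by auto
qed

text \<open>Both functions have the derivative prescribed by the same branch through
  \<open>c\<close>, so they differ by a constant near \<open>snd c\<close>.\<close>

lemma local_primitive_unique:
  assumes "local_primitive P R g U F" "local_primitive P R g V G"
    and c: "c \<in> U" "c \<in> V" "c \<in> regular_curve P R"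
  shows "eventually (\<lambda>z. F z - F (snd c) = G z - G (snd c)) (nhds (snd c))"
proof -
  obtain w0 z0 where [simp]: "c = (w0, z0)"
    by fastforce
  have "(w0, z0) \<in> regular_curve P R"
    using c(3) by simp
  from regular_curve_branch[OF this]
  obtain W d where *: "d > 0" "W holomorphic_on ball z0 d" "W z0 = w0"
    "\<And>z. z \<in> ball z0 d \<Longrightarrow> (W z, z) \<in> regular_curve P R"
    by blast
  have "isCont W z0"
    using * by (meson centre_in_ball continuous_on_eq_continuous_at holomorphic_on_imp_continuous_on open_ball)
  then have "isCont (\<lambda>z. (W z, z)) z0"
    by (intro continuous_intros)
  then have "((\<lambda>z. (W z, z)) \<longlongrightarrow> (W z0, z0)) (nhds z0)"
    by (rule isCont_tendsto_nhds)
  \<comment> \<open>Continuity of the branch keeps its points in both \<open>U\<close> and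
    \<open>V\<close> over a small disc, where both derivative conditions apply.\<close>
  moreover have "open (U \<inter> V)" "(W z0, z0) \<in> U \<inter> V"
    using assms * by (auto simp: local_primitive_def)
  ultimately have "eventually (\<lambda>z. (W z, z) \<in> U \<inter> V) (nhds z0)"
    by (rule topological_tendstoD)
  then obtain e where e: "e > 0" "\<And>z. dist z z0 < e \<Longrightarrow> (W z, z) \<in> U \<inter> V"
    unfolding eventually_nhds_metric by blast
  define r where "r = min d e"
  have "r > 0" using * e by (auto simp: r_def)
  have "\<exists>k. \<forall>z\<in>ball z0 r. F z - G z = k"
  proof (rule has_field_derivative_zero_constant[OF convex_ball])
    fix z assume "z \<in> ball z0 r"
    then have z: "(W z, z) \<in> U" "(W z, z) \<in> V" "(W z, z) \<in> regular_curve P R"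
      using * e by (auto simp: r_def dist_commute)
    have "((\<lambda>z. F z - G z) has_field_derivative
        (g (W z) z / (3 * (W z)^2 - poly P z) - g (W z) z / (3 * (W z)^2 - poly P z))) (at z)"
      using assms(1,2) z by (intro DERIV_diff) (auto simp: local_primitive_def)
    then show "((\<lambda>z. F z - G z) has_field_derivative 0) (at z within ball z0 r)"
      by (simp add: has_field_derivative_at_within)
  qed
  then obtain k where k: "\<And>z. z \<in> ball z0 r \<Longrightarrow> F z - G z = k"
    by blast
  have "F z - F z0 = G z - G z0" if "z \<in> ball z0 r" for z
  proof -
    have "F z - G z = F z0 - G z0"
      using k[OF that] k[of z0] \<open>r > 0\<close> by simp
    then show ?thesis
      by algebra
  qed
  then show ?thesis
    using \<open>r > 0\<close> eventually_nhds_in_open[OF open_ball, of z0 z0 r]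
    by (auto elim: eventually_mono)
qed

text \<open>The integrand of \<open>abelian_integral\<close> with \<open>I2\<close> replaced by a
  fixed polynomial \<open>P\<close>, since the curve will not vary with \<open>x\<close>.\<close>

definition curve_integrand ::
  "complex poly \<Rightarrow> (complex \<Rightarrow> complex \<Rightarrow> complex) \<Rightarrow> (real \<Rightarrow> complex \<times> complex) \<Rightarrow> real \<Rightarrow> complex" where
  "curve_integrand P g c t =
     g (fst (c t)) (snd (c t)) / (3 * (fst (c t))^2 - poly P (snd (c t)))
       * vector_derivative (\<lambda>s. snd (c s)) (at t within {0..1})"

text \<open>As long as the path stays in \<open>U\<close>, the integrand is the derivative of
  \<open>F\<close> along its \<open>z\<close>-component, except at finitely many corners, which the
  strong form of the fundamental theorem permits.\<close>

lemma curve_integrand_has_integral: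
  assumes F: "local_primitive P R g U F" and c: "valid_path (\<lambda>t. snd (c t))"
    and st: "0 \<le> s" "s \<le> t" "t \<le> 1"
    and cU: "\<And>u. u \<in> {s..t} \<Longrightarrow> c u \<in> U \<inter> regular_curve P R"
  shows "(curve_integrand P g c has_integral F (snd (c t)) - F (snd (c s))) {s..t}"
proof -
  obtain S D where "finite S" and cont: "continuous_on {0..1} (\<lambda>t. snd (c t))"
    and D: "\<And>u. u \<in> {0..1} - S \<Longrightarrow> ((\<lambda>t. snd (c t)) has_vector_derivative D u) (at u)"
    using c unfolding valid_path_def piecewise_C1_differentiable_on_def C1_differentiable_on_def
    by metis
  have dF: "(F has_field_derivative
      g (fst (c u)) (snd (c u)) / (3 * (fst (c u))^2 - poly P (snd (c u)))) (at (snd (c u)))"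
    if "u \<in> {s..t}" for u
    using F cU[OF that] by (auto simp: local_primitive_def split: prod.splits)
  show ?thesis
  proof (rule fundamental_theorem_of_calculus_interior_strong[OF \<open>finite S\<close> \<open>s \<le> t\<close>])
    fix u assume u: "u \<in> {s<..<t} - S"
    then have u': "u \<in> {0..1} - S" "u \<in> {s..t}"
      using st by auto
    have "vector_derivative (\<lambda>s. snd (c s)) (at u within {0..1}) = D u"
      using u' by (intro vector_derivative_at_within_ivl D) auto
    then show "((\<lambda>u. F (snd (c u))) has_vector_derivative curve_integrand P g c u) (at u)"
      using field_vector_diff_chain_at[OF D[OF u'(1)] dF[OF u'(2)]]
      by (simp add: curve_integrand_def o_def mult.commute)
  next
    have "continuous_on {s..t} (\<lambda>t. snd (c t))"
      using st by (intro continuous_on_subset[OF cont]) auto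
    moreover have "continuous_on ((\<lambda>t. snd (c t)) ` {s..t}) F"
      using DERIV_isCont[OF dF] by (intro continuous_at_imp_continuous_on) blast
    ultimately show "continuous_on {s..t} (\<lambda>u. F (snd (c u)))"
      using continuous_on_compose2[of "(\<lambda>t. snd (c t)) ` {s..t}" F "{s..t}" "\<lambda>t. snd (c t)"] by blast
  qed
qed

text \<open>Paths with parameter near \<open>x0\<close> pass through the same sheet neighbourhoods
  as \<open>\<gamma> x0\<close>. Increments of local primitives then telescope, the common start
  \<open>b\<close> contributes nothing, and only the end point is left.\<close>

lemma curve_integral_endpoint:
  fixes \<gamma> :: "real \<Rightarrow> real \<Rightarrow> complex \<times> complex"
  assumes cont: "continuous_on (T \<times> {0..1}) (\<lambda>(x, t). \<gamma> x t)" and T: "open T" "x0 \<in> T"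
    and vp: "\<And>x. x \<in> T \<Longrightarrow> valid_path (\<lambda>t. snd (\<gamma> x t))"
    and base: "\<And>x. x \<in> T \<Longrightarrow> \<gamma> x 0 = b"
    and curve: "\<And>x t. x \<in> T \<Longrightarrow> t \<in> {0..1} \<Longrightarrow> \<gamma> x t \<in> regular_curve P R"
    and g: "\<And>A W. open A \<Longrightarrow> W holomorphic_on A \<Longrightarrow> (\<lambda>z. g (W z) z) holomorphic_on A"
    and F: "local_primitive P R g U F" "\<gamma> x0 1 \<in> U"
  shows "eventually (\<lambda>x. integral {0..1} (curve_integrand P g (\<gamma> x)) -
            integral {0..1} (curve_integrand P g (\<gamma> x0)) =
            F (snd (\<gamma> x 1)) - F (snd (\<gamma> x0 1))) (nhds x0)"
proof -
  define f where "f x = curve_integrand P g (\<gamma> x)" for x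
  \<comment> \<open>Quantifying over all local primitives allows a change of primitive at each
    \<open>t\<close>; integrability is carried along so that integrals can be split.\<close>
  define Q where "Q t \<longleftrightarrow> (\<forall>U F. local_primitive P R g U F \<longrightarrow> \<gamma> x0 t \<in> U \<longrightarrow>
      eventually (\<lambda>x. f x integrable_on {0..t} \<and>
        integral {0..t} (f x) - integral {0..t} (f x0) = F (snd (\<gamma> x t)) - F (snd (\<gamma> x0 t))) (nhds x0))"
    for t
  have evT: "eventually (\<lambda>x. x \<in> T) (nhds x0)"
    using T by (rule eventually_nhds_in_open)
  have contx: "((\<lambda>x. \<gamma> x t) \<longlongrightarrow> \<gamma> x0 t) (nhds x0)" if "t \<in> {0..1}" for t
  proof -
    have "continuous_on T (\<lambda>x. \<gamma> x t)"
    proof -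
      have "continuous_on T ((\<lambda>(x, t). \<gamma> x t) \<circ> (\<lambda>x. (x, t)))"
        by (intro continuous_on_compose continuous_intros continuous_on_subset[OF cont])
          (use that in auto)
      then show ?thesis
        by (simp add: o_def)
    qed
    then have "isCont (\<lambda>x. \<gamma> x t) x0"
      using T by (simp add: continuous_on_eq_continuous_at)
    then show ?thesis
      by (rule isCont_tendsto_nhds)
  qed
  \<comment> \<open>The paths depend only continuously on \<open>x\<close>, so the integrals cannot be differentiated under
    the integral sign. Instead \<open>Q\<close> is propagated along the path \<open>\<gamma> x0\<close>.\<close>
  have "Q 1"
  proof (rule connected_induction_simple[of "{0..1::real}" 0 1 Q])
    \<comment> \<open>All paths start at \<open>b\<close>, so both differences are 0.\<close>
    show "Q 0"
      unfolding Q_def using evT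
      by (auto elim!: eventually_mono simp: base T has_integral_integrable[OF has_integral_refl(2)])
  next
    fix t :: real assume t: "t \<in> {0..1}"
    obtain V G where G: "local_primitive P R g V G" "\<gamma> x0 t \<in> V"
      using local_primitive_exists[where g = g, OF curve[OF T(2) t] g] by blast
    then have "open V"
      by (simp add: local_primitive_def)
    \<comment> \<open>Joint continuity yields a product neighbourhood of \<open>(x0, t)\<close>
      mapped into \<open>V\<close>: the single primitive \<open>G\<close> serves all nearby paths on
      the whole interval \<open>I\<close>.\<close>
    obtain B where B: "open B" "B \<inter> (T \<times> {0..1}) = (\<lambda>(x, t). \<gamma> x t) -` V \<inter> (T \<times> {0..1})"
      using cont \<open>open V\<close> unfolding continuous_on_open_invariant by metis
    have "(x0, t) \<in> (\<lambda>(x, t). \<gamma> x t) -` V \<inter> (T \<times> {0..1})"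
      using G(2) t T by simp
    then have "(x0, t) \<in> B"
      unfolding B(2)[symmetric] by simp
    then obtain X N where XN: "open X" "open N" "x0 \<in> X" "t \<in> N" "X \<times> N \<subseteq> B"
      using B(1) by (metis open_prod_elim mem_Times_iff fst_conv snd_conv)
    obtain e where e: "e > 0" "ball t e \<subseteq> N"
      using XN by (meson openE)
    define I where "I = {0..1} \<inter> ball t e"
    have inV: "\<gamma> x u \<in> V" if "x \<in> X \<inter> T" "u \<in> I" for x u
    proof -
      have "(x, u) \<in> X \<times> N" "(x, u) \<in> T \<times> {0..1}"
        using that e by (auto simp: I_def)
      then have "(x, u) \<in> B \<inter> (T \<times> {0..1})"
        using XN by blast
      then show ?thesis
        unfolding B(2) by simp
    qed
    have evX: "eventually (\<lambda>x. x \<in> X \<inter> T) (nhds x0)"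
      using XN T by (intro eventually_nhds_in_open) auto
    have int: "(f x has_integral G (snd (\<gamma> x v)) - G (snd (\<gamma> x u))) {u..v}"
      if "x \<in> X \<inter> T" "u \<in> I" "v \<in> I" "u \<le> v" for x u v
      unfolding f_def
    proof (rule curve_integrand_has_integral[OF G(1) vp])
      fix y assume "y \<in> {u..v}"
      then have "y \<in> I"
        using that by (auto simp: I_def dist_real_def)
      then show "\<gamma> x y \<in> V \<inter> regular_curve P R"
        using inV curve that by (auto simp: I_def)
    qed (use that in \<open>auto simp: I_def\<close>)
    \<comment> \<open>Both orders of \<open>u\<close> and \<open>v\<close> are treated, because
      \<open>Q\<close> has to pass between any two points of \<open>I\<close>.\<close>
    have step: "f x integrable_on {0..v} \<and>
        integral {0..v} (f x) - integral {0..u} (f x) = G (snd (\<gamma> x v)) - G (snd (\<gamma> x u))"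
      if x: "x \<in> X \<inter> T" and u: "u \<in> I" and v: "v \<in> I" and "f x integrable_on {0..u}" for x u v
    proof (cases "u \<le> v")
      case True
      have "f x integrable_on {u..v}" "integral {u..v} (f x) = G (snd (\<gamma> x v)) - G (snd (\<gamma> x u))"
        using int[OF x u v True] by (auto simp: has_integral_integrable integral_unique)
      moreover have "0 \<le> u"
        using u by (auto simp: I_def)
      ultimately have "f x integrable_on {0..v}"
        "integral {0..u} (f x) + integral {u..v} (f x) = integral {0..v} (f x)"
        using True that(4) Henstock_Kurzweil_Integration.integrable_combine[of 0 u v "f x"]
          Henstock_Kurzweil_Integration.integral_combine[of 0 u v "f x"] by auto
      then show ?thesis
        using \<open>integral {u..v} (f x) = _\<close> by (metis add_diff_cancel_left')
    next
      case False
      then have "v \<le> u" by auto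
      have "integral {v..u} (f x) = G (snd (\<gamma> x u)) - G (snd (\<gamma> x v))"
        using int[OF x v u \<open>v \<le> u\<close>] by (auto simp: integral_unique)
      moreover have "0 \<le> v"
        using v by (auto simp: I_def)
      moreover have "f x integrable_on {0..v}"
        using that(4) \<open>v \<le> u\<close> by (auto intro: integrable_on_subinterval)
      ultimately have "integral {0..v} (f x) + integral {v..u} (f x) = integral {0..u} (f x)"
        using \<open>v \<le> u\<close> that(4) Henstock_Kurzweil_Integration.integral_combine[of 0 v u "f x"] by auto
      then have "integral {0..v} (f x) - integral {0..u} (f x) = - integral {v..u} (f x)"
        by (metis add_diff_cancel_left' minus_diff_eq)
      then show ?thesis
        using \<open>integral {v..u} (f x) = _\<close> \<open>f x integrable_on {0..v}\<close> by simp
    qed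
    have "Q v" if u: "u \<in> I" and v: "v \<in> I" and "Q u" for u v
      unfolding Q_def
    proof (intro allI impI)
      fix U F assume F: "local_primitive P R g U F" "\<gamma> x0 v \<in> U"
      have x0: "x0 \<in> X \<inter> T"
        using XN T by auto
      have ev1: "eventually (\<lambda>x. f x integrable_on {0..u} \<and>
        integral {0..u} (f x) - integral {0..u} (f x0) = G (snd (\<gamma> x u)) - G (snd (\<gamma> x0 u))) (nhds x0)"
        using \<open>Q u\<close> G(1) inV[OF x0 u] unfolding Q_def by blast
      then have f0: "f x0 integrable_on {0..u}"
        using eventually_nhds_x_imp_x by fastforce
      have v01: "v \<in> {0..1}"
        using v by (auto simp: I_def)
      have "((\<lambda>x. snd (\<gamma> x v)) \<longlongrightarrow> snd (\<gamma> x0 v)) (nhds x0)"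
        using contx[OF v01] by (rule tendsto_snd)
      \<comment> \<open>Near the point reached at \<open>v\<close>, the increments of the arbitrary
        \<open>F\<close> agree with those of \<open>G\<close>, the primitive used on
        \<open>I\<close>.\<close>
      moreover have "eventually (\<lambda>z. F z - F (snd (\<gamma> x0 v)) = G z - G (snd (\<gamma> x0 v))) (nhds (snd (\<gamma> x0 v)))"
        using local_primitive_unique[OF F(1) G(1) F(2) inV[OF x0 v] curve[OF T(2) v01]] .
      ultimately have "eventually (\<lambda>x. F (snd (\<gamma> x v)) - F (snd (\<gamma> x0 v)) =
          G (snd (\<gamma> x v)) - G (snd (\<gamma> x0 v))) (nhds x0)"
        by (rule eventually_compose_filterlim[rotated])
      then show "eventually (\<lambda>x. f x integrable_on {0..v} \<and>
        integral {0..v} (f x) - integral {0..v} (f x0) = F (snd (\<gamma> x v)) - F (snd (\<gamma> x0 v))) (nhds x0)"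
        using ev1 evX
      proof eventually_elim
        case (elim x)
        have "integral {0..v} (f x) - integral {0..u} (f x) = G (snd (\<gamma> x v)) - G (snd (\<gamma> x u))"
          and "integral {0..v} (f x0) - integral {0..u} (f x0) = G (snd (\<gamma> x0 v)) - G (snd (\<gamma> x0 u))"
          and "integral {0..u} (f x) - integral {0..u} (f x0) = G (snd (\<gamma> x u)) - G (snd (\<gamma> x0 u))"
          using step[OF _ u v, of x] step[OF x0 u v f0] elim by auto
        then have "integral {0..v} (f x) - integral {0..v} (f x0) = F (snd (\<gamma> x v)) - F (snd (\<gamma> x0 v))"
          using elim(1) by algebra
        then show ?case
          using step[OF _ u v, of x] elim by auto
      qed
    qed
    note transport = this
    \<comment> \<open>A property that is locally constant in this sense spreads over the connected
      interval from 0 to 1.\<close>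
    show "\<exists>I. openin (top_of_set {0..1}) I \<and> t \<in> I \<and> (\<forall>x\<in>I. \<forall>y\<in>I. Q x \<longrightarrow> Q y)"
    proof (intro exI conjI ballI impI)
      show "openin (top_of_set {0..1}) I" "t \<in> I"
        using t e by (auto simp: I_def)
    qed (rule transport)
  qed simp_all
  from this[unfolded Q_def, rule_format, OF F] show ?thesis
    by (rule eventually_mono) (simp add: f_def)
qed

section \<open>The stationary flow\<close>

lemma L1_entries:
  "L1 m q $ 1 $ 1 = q / 2" "L1 m q $ 2 $ 2 = - q / 4" "L1 m q $ 3 $ 3 = - q / 4"
  "L1 m q $ 1 $ 2 = m / complex_of_real (sqrt 2) / 2" "L1 m q $ 2 $ 1 = m / complex_of_real (sqrt 2) / 2"
  "L1 m q $ 1 $ 3 = m / complex_of_real (sqrt 2) / 2" "L1 m q $ 3 $ 1 = m / complex_of_real (sqrt 2) / 2"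
  "L1 m q $ 2 $ 3 = 3 * q / 4" "L1 m q $ 3 $ 2 = 3 * q / 4"
  unfolding L1_def vector_scaleR_component vector_3 by (simp_all add: scaleR_conv_of_real)

text \<open>The Lax matrix at a fixed spectral parameter, so that differentiation in
  \<open>x\<close> and matrix algebra take place over the complex numbers.\<close>

definition lax_at :: "complex \<Rightarrow> complex \<Rightarrow> cmat \<Rightarrow> complex \<Rightarrow> cmat" where
  "lax_at m q A z = (\<chi> i j. A $ i $ j + z * L1 m q $ i $ j)"

lemma poly_lax: "poly (lax m q A $ i $ j) z = lax_at m q A z $ i $ j"
  by (simp add: lax_def lax_at_def)

lemma poly_I2: "poly (I2 m q A) z = trace (lax_at m q A z ** lax_at m q A z) / 2"
  by (simp add: I2_def trace_def matrix_matrix_mult_def poly_sum poly_lax)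

lemma poly_I3: "poly (I3 m q A) z = trace (lax_at m q A z ** lax_at m q A z ** lax_at m q A z) / 3"
  by (simp add: I3_def trace_def matrix_matrix_mult_def poly_sum poly_lax)

text \<open>The cross term of half the trace of the square is the trace of
  \<open>L1 m q ** A\<close>; it is linear, so its gradient is constant.\<close>

lemma h_coeff_1: "h_coeff m q 1 A = (\<Sum>i\<in>UNIV. \<Sum>j\<in>UNIV. L1 m q $ j $ i * A $ i $ j)"
  unfolding h_coeff_def I2_def
  by (simp add: trace_def matrix_matrix_mult_def lax_def coeff_sum sum_3 field_simps)

lemma coord_deriv_h_coeff_1: "coord_deriv i j (h_coeff m q 1) A = L1 m q $ j $ i"
proof -
  have "h_coeff m q 1 = (\<lambda>A. \<Sum>i\<in>UNIV. \<Sum>j\<in>UNIV. L1 m q $ j $ i * A $ i $ j)"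
    by (rule ext) (rule h_coeff_1)
  moreover have "coord_deriv k l (\<lambda>A. c) A = 0" for k l c A
    by (simp add: coord_deriv_def)
  ultimately show ?thesis
    using exhaust_3[of i] exhaust_3[of j]
    by (auto simp: sum_3 coord_deriv_add coord_deriv_mult observables.intros coord_deriv_coord)
qed

text \<open>This turns the Hamiltonian equations of \<open>h1\<close> into a Lax equation.\<close>

lemma poisson_coord_h_coeff_1:
  "poisson (\<lambda>A. A $ i $ j) (h_coeff m q 1) A = (L1 m q ** A - A ** L1 m q) $ i $ j"
  unfolding poisson_def coord_deriv_coord coord_deriv_h_coeff_1
  using exhaust_3[of i] exhaust_3[of j]
  by (auto simp: sum_3 matrix_matrix_mult_def algebra_simps)

text \<open>\<open>L1\<close> commutes with \<open>z * L1\<close>, so the Lax equation holds at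
  every value of the spectral parameter.\<close>

lemma commutator_lax_at:
  "L1 m q ** lax_at m q A z - lax_at m q A z ** L1 m q = L1 m q ** A - A ** L1 m q"
  by (simp add: vec_eq_iff matrix_matrix_mult_def lax_at_def algebra_simps sum.distrib sum_distrib_left)

lemma lax_at_flow:
  assumes "stationary_flow m q T L" "x \<in> T"
  shows "((\<lambda>y. lax_at m q (L y) z $ i $ j) has_vector_derivative
           (L1 m q ** lax_at m q (L x) z - lax_at m q (L x) z ** L1 m q) $ i $ j) (at x)"
proof -
  have "((\<lambda>y. L y $ i $ j) has_vector_derivative (L1 m q ** L x - L x ** L1 m q) $ i $ j) (at x)"
  proof -
    have "\<forall>F\<in>observables. ((\<lambda>y. F (L y)) has_vector_derivative poisson F (h_coeff m q 1) (L x)) (at x)"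
      using assms by (simp add: stationary_flow_def)
    from bspec[OF this observables.coord[of i j]] show ?thesis
      by (simp only: poisson_coord_h_coeff_1)
  qed
  then have "((\<lambda>y. L y $ i $ j + z * L1 m q $ i $ j) has_vector_derivative (L1 m q ** L x - L x ** L1 m q) $ i $ j + 0) (at x)"
    by (intro derivative_intros)
  then show ?thesis
    by (simp add: commutator_lax_at) (simp add: lax_at_def)
qed

section \<open>Conservation of the spectral curve\<close>

lemma trace_square_3: "trace (M ** M) = (\<Sum>i\<in>UNIV. \<Sum>j\<in>UNIV. M $ i $ j * M $ j $ i)" for M :: cmat
  by (simp add: trace_def matrix_matrix_mult_def)

lemma trace_cube_3: "trace (M ** M ** M) = (\<Sum>i\<in>UNIV. \<Sum>j\<in>UNIV. \<Sum>k\<in>UNIV. M $ i $ k * M $ k $ j * M $ j $ i)" for M :: cmat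
  by (simp add: trace_def matrix_matrix_mult_def sum_distrib_right)

text \<open>By the Lax equation the derivative of the trace is that of a product of
  \<open>\<Lambda> x\<close> with a commutator \<open>[L1, \<Lambda> x]\<close>, which vanishes by
  cyclicity. The cubic trace below is treated alike.\<close>

lemma isospectral_I2:
  assumes "stationary_flow m q T L" "x \<in> T"
  shows "((\<lambda>y. poly (I2 m q (L y)) z) has_vector_derivative 0) (at x)"
proof -
  define \<Lambda> where "\<Lambda> y = lax_at m q (L y) z" for y
  define K where "K = L1 m q ** \<Lambda> x - \<Lambda> x ** L1 m q"
  have d: "((\<lambda>y. \<Lambda> y $ i $ j) has_vector_derivative K $ i $ j) (at x)" for i j
    using lax_at_flow[OF assms] by (simp add: \<Lambda>_def K_def)
  have "((\<lambda>y. trace (\<Lambda> y ** \<Lambda> y)) has_vector_derivative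
      (\<Sum>i\<in>UNIV. \<Sum>j\<in>UNIV. \<Lambda> x $ i $ j * K $ j $ i + K $ i $ j * \<Lambda> x $ j $ i)) (at x)"
    unfolding trace_square_3 by (intro derivative_intros d)
  also have "(\<Sum>i\<in>UNIV. \<Sum>j\<in>UNIV. \<Lambda> x $ i $ j * K $ j $ i + K $ i $ j * \<Lambda> x $ j $ i) = 0"
    by (simp add: K_def matrix_matrix_mult_def sum_3 algebra_simps)
  finally show ?thesis
    unfolding poly_I2 \<Lambda>_def[symmetric] using has_vector_derivative_divide[of _ 0 _ 2] by fastforce
qed

lemma isospectral_I3:
  assumes "stationary_flow m q T L" "x \<in> T"
  shows "((\<lambda>y. poly (I3 m q (L y)) z) has_vector_derivative 0) (at x)"
proof -
  define \<Lambda> where "\<Lambda> y = lax_at m q (L y) z" for y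
  define K where "K = L1 m q ** \<Lambda> x - \<Lambda> x ** L1 m q"
  have d: "((\<lambda>y. \<Lambda> y $ i $ j) has_vector_derivative K $ i $ j) (at x)" for i j
    using lax_at_flow[OF assms] by (simp add: \<Lambda>_def K_def)
  have "((\<lambda>y. trace (\<Lambda> y ** \<Lambda> y ** \<Lambda> y)) has_vector_derivative
      (\<Sum>i\<in>UNIV. \<Sum>j\<in>UNIV. \<Sum>k\<in>UNIV. \<Lambda> x $ i $ k * \<Lambda> x $ k $ j * K $ j $ i +
         (\<Lambda> x $ i $ k * K $ k $ j + K $ i $ k * \<Lambda> x $ k $ j) * \<Lambda> x $ j $ i)) (at x)"
    unfolding trace_cube_3 by (intro derivative_intros d)
  also have "(\<Sum>i\<in>UNIV. \<Sum>j\<in>UNIV. \<Sum>k\<in>UNIV. \<Lambda> x $ i $ k * \<Lambda> x $ k $ j * K $ j $ i +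
         (\<Lambda> x $ i $ k * K $ k $ j + K $ i $ k * \<Lambda> x $ k $ j) * \<Lambda> x $ j $ i) = 0"
    by (simp add: K_def matrix_matrix_mult_def sum_3 algebra_simps)
  finally show ?thesis
    unfolding poly_I3 \<Lambda>_def[symmetric] using has_vector_derivative_divide[of _ 0 _ 3] by fastforce
qed

section \<open>The equations for the roots\<close>

lemma has_vector_derivative_at_iff_difference_quotient:
  "(f has_vector_derivative D) (at x) \<longleftrightarrow> ((\<lambda>y. (f y - f x) /\<^sub>R (y - x)) \<longlongrightarrow> D) (at x)"
proof -
  have "((\<lambda>y. norm (f y - f x - (y - x) *\<^sub>R D) / norm (y - x)) \<longlongrightarrow> 0) (at x) \<longleftrightarrow>
        ((\<lambda>y. norm ((f y - f x) /\<^sub>R (y - x) - D)) \<longlongrightarrow> 0) (at x)"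
  proof (rule filterlim_cong[OF refl refl])
    have "norm (f y - f x - (y - x) *\<^sub>R D) / norm (y - x) = norm ((f y - f x) /\<^sub>R (y - x) - D)"
      if "y \<noteq> x" for y
    proof -
      have "(f y - f x) /\<^sub>R (y - x) - D = (f y - f x - (y - x) *\<^sub>R D) /\<^sub>R (y - x)"
        using that by (simp add: scaleR_diff_right)
      then show ?thesis
        by (simp add: divide_inverse mult.commute)
    qed
    then show "\<forall>\<^sub>F y in at x. norm (f y - f x - (y - x) *\<^sub>R D) / norm (y - x) =
        norm ((f y - f x) /\<^sub>R (y - x) - D)"
      by (auto simp: eventually_at_filter)
  qed
  then show ?thesis
    unfolding has_vector_derivative_def has_derivative_iff_norm tendsto_norm_zero_iff
    by (simp add: LIM_zero_iff bounded_linear_scaleR_left)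
qed

text \<open>Because \<open>f x = 0\<close>, the difference quotient of the product is that of
  \<open>f\<close> times \<open>g y\<close>, and continuity gives the limit.\<close>

lemma has_vector_derivative_mult_continuous_at_zero:
  fixes f g :: "real \<Rightarrow> 'a :: real_normed_algebra"
  assumes "(f has_vector_derivative D) (at x)" "f x = 0" "isCont g x"
  shows "((\<lambda>y. f y * g y) has_vector_derivative D * g x) (at x)"
  using assms tendsto_mult[of "\<lambda>y. f y /\<^sub>R (y - x)" D "at x" g "g x"]
  by (simp add: has_vector_derivative_at_iff_difference_quotient isCont_def)

lemma cubic_factorization:
  fixes c d e g r1 r2 r3 :: "'a :: field"
  assumes "r1 \<noteq> r2" "r1 \<noteq> r3" "r2 \<noteq> r3"
    and "c * r1^3 + d * r1^2 + e * r1 + g = 0" "c * r2^3 + d * r2^2 + e * r2 + g = 0"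
      "c * r3^3 + d * r3^2 + e * r3 + g = 0"
  shows "c * z^3 + d * z^2 + e * z + g = c * (z - r1) * (z - r2) * (z - r3)"
proof -
  \<comment> \<open>Divided differences: cancelling differences of distinct roots lowers the degree
    twice and gives the Vieta relations.\<close>
  have "(r1 - r2) * (c * (r1^2 + r1*r2 + r2^2) + d * (r1 + r2) + e) = 0"
    using assms(4,5) by algebra
  then have 1: "c * (r1^2 + r1*r2 + r2^2) + d * (r1 + r2) + e = 0"
    using assms(1) by simp
  have "(r1 - r3) * (c * (r1^2 + r1*r3 + r3^2) + d * (r1 + r3) + e) = 0"
    using assms(4,6) by algebra
  then have 2: "c * (r1^2 + r1*r3 + r3^2) + d * (r1 + r3) + e = 0"
    using assms(2) by simp
  have "(r2 - r3) * (c * (r1 + r2 + r3) + d) = 0"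
    using 1 2 by algebra
  then have 3: "c * (r1 + r2 + r3) + d = 0"
    using assms(3) by simp
  show ?thesis
    using 1 3 assms(4) by algebra
qed

section \<open>The polynomial B and its values at the roots\<close>

text \<open>The coefficient of \<open>z^3\<close> in \<open>Bpoly\<close>, simplified with
  \<open>L1\<close> entries: 12 and 21 both equal \<open>a\<close>, and 11 minus 22 equals
  \<open>b\<close>. It is the same at all points of phase space.\<close>

definition Bpoly_lead :: "complex \<Rightarrow> complex \<Rightarrow> complex" where
  "Bpoly_lead m q = (let a = L1 m q $ 3 $ 1; b = L1 m q $ 3 $ 2 in 2 * a * b^2 - a^3)"

text \<open>The value is \<open>m / (2 * sqrt 2)\<close> times \<open>(9 * q^2 - m^2) / 8\<close>,
  which is where the two conditions on \<open>m\<close> and \<open>q\<close> come from.\<close>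

lemma Bpoly_lead_nonzero:
  assumes "m \<noteq> 0" "m^2 \<noteq> 9 * q^2"
  shows "Bpoly_lead m q \<noteq> 0"
proof -
  define s where "s = complex_of_real (sqrt 2)"
  have s: "s^2 = 2" "s \<noteq> 0"
    unfolding s_def by (simp_all flip: of_real_power)
  have "Bpoly_lead m q = (m / s / 2) * (2 * (3 * q / 4)^2 - (m / s / 2)^2)"
    by (simp add: Bpoly_lead_def L1_entries s_def[symmetric] power3_eq_cube power2_eq_square algebra_simps)
  also have "(m / s / 2)^2 = m^2 / 8"
    using s by (simp add: power_divide)
  finally show ?thesis
    using assms s by (auto simp: power_mult_distrib power_divide)
qed

text \<open>The value of \<open>L\<^sup>(\<^sup>1\<^sup>)\<^sub>3\<^sub>1 L\<^sub>3\<^sub>2(\<lambda>) - L\<^sup>(\<^sup>1\<^sup>)\<^sub>3\<^sub>2 L\<^sub>3\<^sub>1(\<lambda>)\<close>, which does not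
  depend on \<open>\<lambda>\<close>.\<close>

definition pivot :: "complex \<Rightarrow> complex \<Rightarrow> cmat \<Rightarrow> complex" where
  "pivot m q A = L1 m q $ 3 $ 1 * A $ 3 $ 2 - L1 m q $ 3 $ 2 * A $ 3 $ 1"

lemma poly_Bpoly:
  "poly (Bpoly m q A) z = (let M = lax_at m q A z in
     (M $ 1 $ 1 - M $ 2 $ 2) * M $ 3 $ 1 * M $ 3 $ 2 - M $ 1 $ 2 * (M $ 3 $ 1)^2 + M $ 2 $ 1 * (M $ 3 $ 2)^2)"
  by (simp add: Bpoly_def Let_def poly_lax)

lemma Bpoly_cubic:
  obtains d e g where "\<And>z. poly (Bpoly m q A) z = Bpoly_lead m q * z^3 + d * z^2 + e * z + g"
proof -
  define a b where "a = m / complex_of_real (sqrt 2) / 2" and "b = 3 * q / 4"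
  define D x0 y0 s t where "D = A $ 1 $ 1 - A $ 2 $ 2" and "x0 = A $ 3 $ 1" and "y0 = A $ 3 $ 2"
    and "s = A $ 1 $ 2" and "t = A $ 2 $ 1"
  have "poly (Bpoly m q A) z = Bpoly_lead m q * z^3 +
      (D * a * b + b * (x0 * b + a * y0) - (s * a^2 + 2 * a^2 * x0) + (t * b^2 + 2 * a * b * y0)) * z^2 +
      (D * (x0 * b + a * y0) + b * x0 * y0 - (2 * s * a * x0 + a * x0^2) + (2 * t * b * y0 + a * y0^2)) * z +
      (D * x0 * y0 - s * x0^2 + t * y0^2)" for z
  proof -
    have D': "A $ 1 $ 1 + z * (q / 2) - (A $ 2 $ 2 + z * (- q / 4)) = D + z * b"
      by (simp add: D_def b_def field_simps)
    show ?thesis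
      unfolding poly_Bpoly Let_def lax_at_def vec_lambda_beta L1_entries D' Bpoly_lead_def
      unfolding a_def[symmetric] b_def[symmetric] x0_def[symmetric] y0_def[symmetric] 
        s_def[symmetric] t_def[symmetric]
      by algebra
  qed
  then show thesis
    by (rule that)
qed

text \<open>At a root of \<open>\<B>\<close> the vector \<open>(L\<^sub>3\<^sub>2, -L\<^sub>3\<^sub>1, 0)\<close> is an eigenvector
  with eigenvalue \<open>w\<close>; this parametrizes the upper left block by \<open>w\<close>, \<open>p\<close> and \<open>r\<close>.\<close>

lemma eigenvector_parametrization:
  fixes l11 l12 l21 l22 x y :: "'a :: field"
  assumes "x \<noteq> 0" "y \<noteq> 0" "(l11 - l22) * x * y - l12 * x^2 + l21 * y^2 = 0"
  obtains p r where "l12 = y * p" "l21 = x * r" "l11 = l11 - l12 * x / y + p * x"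
    "l22 = l11 - l12 * x / y + r * y"
proof
  show "l12 = y * (l12 / y)" "l21 = x * (l21 / x)" "l11 = l11 - l12 * x / y + l12 / y * x"
    using assms by simp_all
  have "x * y * l22 = x * y * (l11 - l12 * x / y + l21 / x * y)"
    using assms by (simp add: field_simps power2_eq_square)
  then show "l22 = l11 - l12 * x / y + l21 / x * y"
    using assms(1,2) by (metis mult_cancel_left no_zero_divisors)
qed

text \<open>After the Lax equation is inserted and the upper left block is expressed through
  \<open>w\<close>, \<open>p\<close> and \<open>r\<close>, the claim is a polynomial
  identity.\<close>

lemma Bpoly_flow:
  assumes "stationary_flow m q T L" "x \<in> T"
    and B: "poly (Bpoly m q (L x)) z = 0"
    and nz: "poly (lax m q (L x) $ 3 $ 1) z \<noteq> 0" "poly (lax m q (L x) $ 3 $ 2) z \<noteq> 0"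
  shows "((\<lambda>y. poly (Bpoly m q (L y)) z) has_vector_derivative
     pivot m q (L x) * (3 * (wval m q (L x) z)^2 - poly (I2 m q (L x)) z)) (at x)"
proof -
  define M where "M = lax_at m q (L x) z"
  define K where "K = L1 m q ** M - M ** L1 m q"
  have d: "((\<lambda>y. lax_at m q (L y) z $ i $ j) has_vector_derivative K $ i $ j) (at x)" for i j
    using lax_at_flow[OF assms(1,2)] by (simp add: M_def K_def)
  define a b c where "a = m / complex_of_real (sqrt 2) / 2" and "b = 3 * q / 4" and "c = q / 4"
  have L1: "L1 m q $ 1 $ 1 = 2 * c" "L1 m q $ 2 $ 2 = - c" "L1 m q $ 3 $ 3 = - c"
    "L1 m q $ 1 $ 2 = a" "L1 m q $ 2 $ 1 = a" "L1 m q $ 1 $ 3 = a" "L1 m q $ 3 $ 1 = a"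
    "L1 m q $ 2 $ 3 = 3 * c" "L1 m q $ 3 $ 2 = 3 * c"
    by (simp_all add: L1_entries a_def c_def)
  define \<xi> \<eta> w where "\<xi> = M $ 3 $ 1" and "\<eta> = M $ 3 $ 2" and "w = M $ 1 $ 1 - M $ 1 $ 2 * \<xi> / \<eta>"
  obtain p r where pr: "M $ 1 $ 2 = \<eta> * p" "M $ 2 $ 1 = \<xi> * r" "M $ 1 $ 1 = w + p * \<xi>"
    "M $ 2 $ 2 = w + r * \<eta>"
    using eigenvector_parametrization[of \<xi> \<eta> "M $ 1 $ 1" "M $ 2 $ 2" "M $ 1 $ 2" "M $ 2 $ 1"] nz B
    unfolding poly_lax poly_Bpoly Let_def M_def[symmetric] \<xi>_def[symmetric] \<eta>_def[symmetric] w_def[symmetric]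
    by blast
  \<comment> \<open>\<open>L x\<close> and \<open>L1\<close> are both traceless, so the last
    diagonal entry can be eliminated.\<close>
  have tr: "M $ 3 $ 3 = - M $ 1 $ 1 - M $ 2 $ 2"
  proof -
    have "L x $ 1 $ 1 + L x $ 2 $ 2 + L x $ 3 $ 3 = 0"
      using assms(1,2) by (simp add: stationary_flow_def phase_space_def trace_def sum_3)
    then show ?thesis
      by (simp add: M_def lax_at_def L1 algebra_simps add_eq_0_iff)
  qed
  have pivot: "pivot m q (L x) = a * \<eta> - 3 * c * \<xi>"
    by (simp add: pivot_def L1 \<xi>_def \<eta>_def M_def lax_at_def algebra_simps)
  have I2: "2 * poly (I2 m q (L x)) z = (\<Sum>i\<in>UNIV. \<Sum>j\<in>UNIV. M $ i $ j * M $ j $ i)"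
    by (simp add: poly_I2 trace_square_3 flip: M_def)
  have w: "wval m q (L x) z = w"
    by (simp add: wval_def Let_def poly_lax w_def \<xi>_def \<eta>_def flip: M_def)
  have "((\<lambda>y. poly (Bpoly m q (L y)) z) has_vector_derivative
    ((M $ 1 $ 1 - M $ 2 $ 2) * M $ 3 $ 1 * K $ 3 $ 2 +
     ((M $ 1 $ 1 - M $ 2 $ 2) * K $ 3 $ 1 + (K $ 1 $ 1 - K $ 2 $ 2) * M $ 3 $ 1) * M $ 3 $ 2
     - (M $ 1 $ 2 * (M $ 3 $ 1 * K $ 3 $ 1 + K $ 3 $ 1 * M $ 3 $ 1) + K $ 1 $ 2 * (M $ 3 $ 1 * M $ 3 $ 1))
     + (M $ 2 $ 1 * (M $ 3 $ 2 * K $ 3 $ 2 + K $ 3 $ 2 * M $ 3 $ 2) + K $ 2 $ 1 * (M $ 3 $ 2 * M $ 3 $ 2)))) (at x)"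
    (is "(_ has_vector_derivative ?E) _")
    unfolding poly_Bpoly Let_def power2_eq_square M_def by (intro derivative_intros d)
  also have "?E = pivot m q (L x) * (3 * (wval m q (L x) z)^2 - poly (I2 m q (L x)) z)"
  proof -
    have "2 * ?E = pivot m q (L x) * (6 * (wval m q (L x) z)^2 - 2 * poly (I2 m q (L x)) z)"
      unfolding I2 w pivot K_def sum_3 matrix_matrix_mult_def vector_minus_component vec_lambda_beta L1 tr pr
        \<xi>_def[symmetric] \<eta>_def[symmetric]
      by algebra
    then have "2 * ?E = 2 * (pivot m q (L x) * (3 * (wval m q (L x) z)^2 - poly (I2 m q (L x)) z))"
      by algebra
    then show ?thesis
      by (simp only: mult_cancel_left) simp
  qed
  finally show ?thesis .
qed

text \<open>Thus \<open>w\<^sub>1\<close>, \<open>w\<^sub>2\<close>, \<open>w\<^sub>3\<close> are interpolated by a quadratic polynomial in \<open>\<lambda>\<close>, and \<open>det (What \<dots>)\<close>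
  is a multiple of a Vandermonde determinant.\<close>

lemma pivot_mult_wval:
  obtains d e where "\<And>z. poly (Bpoly m q A) z = 0 \<Longrightarrow>
    poly (lax m q A $ 3 $ 1) z \<noteq> 0 \<Longrightarrow> poly (lax m q A $ 3 $ 2) z \<noteq> 0 \<Longrightarrow>
    pivot m q A * wval m q A z = Bpoly_lead m q * z^2 + d * z + e"
proof -
  define a c where "a = m / complex_of_real (sqrt 2) / 2" and "c = q / 4"
  define x0 y0 s t where "x0 = A $ 3 $ 1" and "y0 = A $ 3 $ 2" and "s = A $ 1 $ 2" and "t = A $ 2 $ 1"
  define k l where "k = A $ 1 $ 1" and "l = A $ 2 $ 2"
  have L1: "L1 m q $ 1 $ 1 = 2 * c" "L1 m q $ 2 $ 2 = - c"
    "L1 m q $ 1 $ 2 = a" "L1 m q $ 2 $ 1 = a" "L1 m q $ 3 $ 1 = a" "L1 m q $ 3 $ 2 = 3 * c"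
    by (simp_all add: L1_entries a_def c_def)
  have "pivot m q A * wval m q A z = Bpoly_lead m q * z^2 +
      (a * (k * (3 * c) + 2 * c * y0 - s * a - a * x0) - 3 * c * (l * a - c * x0 - t * (3 * c) - a * y0)) * z +
      (a * (k * y0 - s * x0) - 3 * c * (l * x0 - t * y0))"
    if B: "poly (Bpoly m q A) z = 0"
      and nz: "poly (lax m q A $ 3 $ 1) z \<noteq> 0" "poly (lax m q A $ 3 $ 2) z \<noteq> 0" for z
  proof -
    define M where "M = lax_at m q A z"
    define x y w where "x = M $ 3 $ 1" and "y = M $ 3 $ 2" and "w = M $ 1 $ 1 - M $ 1 $ 2 * x / y"
    obtain p r where pr: "M $ 1 $ 2 = y * p" "M $ 2 $ 1 = x * r" "M $ 1 $ 1 = w + p * x"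
      "M $ 2 $ 2 = w + r * y"
      using eigenvector_parametrization[of x y "M $ 1 $ 1" "M $ 2 $ 2" "M $ 1 $ 2" "M $ 2 $ 1"] nz B
      unfolding poly_lax poly_Bpoly Let_def M_def[symmetric] x_def[symmetric] y_def[symmetric] w_def[symmetric]
      by blast
    have w: "wval m q A z = w"
      by (simp add: wval_def Let_def poly_lax w_def x_def y_def flip: M_def)
    have pivot: "pivot m q A = a * y - 3 * c * x"
      by (simp add: pivot_def L1 x_def y_def M_def lax_at_def algebra_simps)
    \<comment> \<open>The two rows of the eigenvector equation express \<open>w * y\<close> and
      \<open>w * x\<close> without division, and \<open>pivot\<close> is a combination of
      \<open>x\<close> and \<open>y\<close>; the right side is visibly quadratic in
      \<open>z\<close>.\<close>
    have "pivot m q A * w = a * (M $ 1 $ 1 * y - M $ 1 $ 2 * x) - 3 * c * (M $ 2 $ 2 * x - M $ 2 $ 1 * y)"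
      unfolding pivot pr by algebra
    then show ?thesis
      unfolding w x_def y_def M_def lax_at_def vec_lambda_beta L1 Bpoly_lead_def Let_def
        x0_def[symmetric] y0_def[symmetric] s_def[symmetric] t_def[symmetric] k_def[symmetric] l_def[symmetric]
      by algebra
  qed
  then show thesis
    by (rule that)
qed

lemma det_What:
  "det (What m q A r) = wval m q A (r 1) * (r 2 - r 3) + wval m q A (r 2) * (r 3 - r 1) + wval m q A (r 3) * (r 1 - r 2)"
  by (simp add: What_def det_3 algebra_simps)

text \<open>The part \<open>d * z + e\<close> of the interpolating quadratic is a combination of the
  other two columns of \<open>What\<close> and drops out of the determinant.\<close>

lemma pivot_mult_det_What:
  assumes "generic m q A r"
  shows "pivot m q A * det (What m q A r) = Bpoly_lead m q * (r 1 - r 2) * (r 1 - r 3) * (r 2 - r 3)"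
proof -
  obtain d e where *: "\<And>z. poly (Bpoly m q A) z = 0 \<Longrightarrow>
    poly (lax m q A $ 3 $ 1) z \<noteq> 0 \<Longrightarrow> poly (lax m q A $ 3 $ 2) z \<noteq> 0 \<Longrightarrow>
    pivot m q A * wval m q A z = Bpoly_lead m q * z^2 + d * z + e"
    using pivot_mult_wval by blast
  have k: "pivot m q A * wval m q A (r k) = Bpoly_lead m q * (r k)^2 + d * r k + e" for k
    using assms by (intro *) (auto simp: generic_def)
  show ?thesis
    unfolding det_What using k[of 1] k[of 2] k[of 3] by algebra
qed

lemma Bpoly_factorization:
  assumes "generic m q A r"
  shows "poly (Bpoly m q A) z = Bpoly_lead m q * (z - r 1) * (z - r 2) * (z - r 3)"
proof -
  obtain d e g where *: "\<And>z. poly (Bpoly m q A) z = Bpoly_lead m q * z^3 + d * z^2 + e * z + g"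
    using Bpoly_cubic by blast
  have "inj r" and "\<And>k. poly (Bpoly m q A) (r k) = 0"
    using assms by (auto simp: generic_def)
  then show ?thesis
    unfolding * by (intro cubic_factorization) (auto dest: injD)
qed

text \<open>Since \<open>f\<close> vanishes at \<open>x\<close>, the identity \<open>f = (r1 x - r1) \<cdot> h\<close> with \<open>h\<close> merely continuous
  suffices to differentiate \<open>r1\<close>; no implicit function theorem is needed.\<close>

lemma root_has_vector_derivative:
  fixes r1 r2 r3 f :: "real \<Rightarrow> complex"
  assumes T: "open T" "x \<in> T"
    and f: "\<And>y. y \<in> T \<Longrightarrow> f y = c * (r1 x - r1 y) * (r1 x - r2 y) * (r1 x - r3 y)"
    and f': "(f has_vector_derivative D) (at x)"
    and cont: "isCont r2 x" "isCont r3 x"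
    and nz: "c \<noteq> 0" "r1 x \<noteq> r2 x" "r1 x \<noteq> r3 x"
  shows "(r1 has_vector_derivative - D / (c * (r1 x - r2 x) * (r1 x - r3 x))) (at x)"
proof -
  define h where "h y = c * (r1 x - r2 y) * (r1 x - r3 y)" for y
  have h: "isCont h x" "h x \<noteq> 0"
    using nz unfolding h_def by (auto intro!: continuous_intros cont)
  have "f x = 0"
    using f[OF T(2)] by simp
  then have "((\<lambda>y. f y * inverse (h y)) has_vector_derivative D * inverse (h x)) (at x)"
    using h f' by (intro has_vector_derivative_mult_continuous_at_zero continuous_intros) auto
  then have "((\<lambda>y. r1 x - f y * inverse (h y)) has_vector_derivative 0 - D * inverse (h x)) (at x)"
    by (intro derivative_intros)
  \<comment> \<open>Near \<open>x\<close> the factor \<open>h\<close> is nonzero, so the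
    factorization can be solved for \<open>r1 y\<close>.\<close>
  moreover have "eventually (\<lambda>y. r1 x - f y * inverse (h y) = r1 y) (nhds x)"
  proof -
    have "(h \<longlongrightarrow> h x) (nhds x)"
      using h(1) by (metis isCont_def tendsto_at_iff_tendsto_nhds)
    then have "eventually (\<lambda>y. h y \<noteq> 0) (nhds x)"
      using h(2) tendsto_imp_eventually_ne by blast
    then show ?thesis
      using eventually_nhds_in_open[OF T]
    proof eventually_elim
      case (elim y)
      then have "f y = (r1 x - r1 y) * h y"
        by (simp add: f h_def)
      with elim show ?case
        by (simp add: mult.assoc)
    qed
  qed
  ultimately have "(r1 has_vector_derivative 0 - D * inverse (h x)) (at x)"
    using has_vector_derivative_cong_ev[where S = UNIV and f = "\<lambda>y. r1 x - f y * inverse (h y)" and g = r1] \<open>f x = 0\<close>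
    by (auto elim: eventually_mono)
  then show ?thesis
    by (simp add: h_def divide_inverse)
qed

lemma dubrovin_equation:
  assumes nz: "m \<noteq> 0" "m^2 \<noteq> 9 * q^2"
    and T: "open T" and flow: "stationary_flow m q T L"
    and lam_cont: "\<And>k. continuous_on T (lam k)"
    and gen: "\<And>x. x \<in> T \<Longrightarrow> generic m q (L x) (\<lambda>k. lam k x)"
    and x: "x \<in> T" and kij: "(k, i, j) \<in> {(1, 2, 3), (2, 3, 1), (3, 1, 2 :: 3)}"
  shows "(lam k has_vector_derivative
           - ((3 * (wval m q (L x) (lam k x))^2 - poly (I2 m q (L x)) (lam k x))
                * (lam i x - lam j x))
             / det (What m q (L x) (\<lambda>k. lam k x))) (at x)"
proof -
  define W where "W = det (What m q (L x) (\<lambda>k. lam k x))"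
  define G where "G = 3 * (wval m q (L x) (lam k x))^2 - poly (I2 m q (L x)) (lam k x)"
  have ne: "lam k x \<noteq> lam i x" "lam k x \<noteq> lam j x" "lam i x \<noteq> lam j x"
  proof -
    have "inj (\<lambda>k. lam k x)"
      using gen[OF x] by (simp add: generic_def)
    moreover have "k \<noteq> i" "k \<noteq> j" "i \<noteq> j"
      using kij by auto
    ultimately show "lam k x \<noteq> lam i x" "lam k x \<noteq> lam j x" "lam i x \<noteq> lam j x"
      by (auto dest: injD)
  qed
  have "isCont (lam k) x" for k
    using lam_cont T x by (simp add: continuous_on_eq_continuous_at)
  \<comment> \<open>B is evaluated at the fixed number \<open>lam k x\<close> while its coefficients
    move with \<open>y\<close>.\<close>
  note root_has_vector_derivative[where ?r2.0 = "lam i" and ?r3.0 = "lam j" and ?r1.0 = "lam k"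
      and f = "\<lambda>y. poly (Bpoly m q (L y)) (lam k x)" and c = "Bpoly_lead m q" and D = "pivot m q (L x) * G",
      OF T x _ _ this this Bpoly_lead_nonzero[OF nz] ne(1,2)]
  then have "(lam k has_vector_derivative - (pivot m q (L x) * G) /
       (Bpoly_lead m q * (lam k x - lam i x) * (lam k x - lam j x))) (at x)"
  proof this
    show "poly (Bpoly m q (L y)) (lam k x) =
        Bpoly_lead m q * (lam k x - lam k y) * (lam k x - lam i y) * (lam k x - lam j y)" if "y \<in> T" for y
      unfolding Bpoly_factorization[OF gen[OF that]] using kij by auto
    show "((\<lambda>y. poly (Bpoly m q (L y)) (lam k x)) has_vector_derivative pivot m q (L x) * G) (at x)"
      unfolding G_def using gen[OF x] by (intro Bpoly_flow[OF flow x]) (auto simp: generic_def)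
  qed
  also have "- (pivot m q (L x) * G) / (Bpoly_lead m q * (lam k x - lam i x) * (lam k x - lam j x)) =
      - (G * (lam i x - lam j x)) / W"
  proof -
    \<comment> \<open>The Vandermonde product is invariant under cyclic permutations, so the formula
      for the order 1, 2, 3 covers all three cases.\<close>
    have "pivot m q (L x) * W = Bpoly_lead m q * (lam k x - lam i x) * (lam k x - lam j x) * (lam i x - lam j x)"
    proof -
      have eq: "pivot m q (L x) * W = Bpoly_lead m q * (lam 1 x - lam 2 x) * (lam 1 x - lam 3 x) * (lam 2 x - lam 3 x)"
        using pivot_mult_det_What[OF gen[OF x]] by (simp add: W_def)
      consider "k = 1" "i = 2" "j = 3" | "k = 2" "i = 3" "j = 1" | "k = 3" "i = 1" "j = 2"
        using kij by auto
      then show ?thesis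
      proof cases
        case 1
        with eq show ?thesis by simp
      next
        case 2
        show ?thesis unfolding 2 eq by algebra
      next
        case 3
        show ?thesis unfolding 3 eq by algebra
      qed
    qed
    moreover have "W \<noteq> 0"
      using gen[OF x] by (simp add: generic_def W_def)
    moreover have "Bpoly_lead m q * (lam k x - lam i x) * (lam k x - lam j x) \<noteq> 0"
      using ne Bpoly_lead_nonzero[OF nz] by simp
    moreover have "- (pivot m q (L x) * G) * W =
        - (G * (lam i x - lam j x)) * (Bpoly_lead m q * (lam k x - lam i x) * (lam k x - lam j x))"
      using calculation(1) by algebra
    ultimately show ?thesis
      by (metis frac_eq_eq)
  qed
  finally show ?thesis
    unfolding G_def W_def .
qed

section \<open>Abelian sums\<close>

lemma constant_on_connected_open:
  fixes f :: "real \<Rightarrow> complex"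
  assumes "open T" "connected T" "\<And>x. x \<in> T \<Longrightarrow> (f has_vector_derivative 0) (at x)"
    and "x \<in> T" "y \<in> T"
  shows "f x = f y"
proof -
  have "convex T"
    using assms(2) is_interval_convex_1 is_interval_connected_1 by blast
  moreover have "(f has_derivative (\<lambda>h. 0)) (at x within T)" if "x \<in> T" for x
    using assms(3)[OF that] by (simp add: has_vector_derivative_def has_derivative_at_withinI)
  ultimately show ?thesis
    using has_derivative_zero_constant[of T f] assms(4,5) by metis
qed

lemma abelian_integral_has_vector_derivative:
  assumes T: "open T" "connected T" and flow: "stationary_flow m q T L" and x0: "x0 \<in> T"
    and p: "path_family m q T L l b p"
    and l: "(l has_vector_derivative D) (at x0)"
    and g: "\<And>A W. open A \<Longrightarrow> W holomorphic_on A \<Longrightarrow> (\<lambda>z. g (W z) z) holomorphic_on A"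
  shows "((\<lambda>x. abelian_integral m q (L x) g (p x)) has_vector_derivative
     D * (g (wval m q (L x0) (l x0)) (l x0) /
       (3 * (wval m q (L x0) (l x0))^2 - poly (I2 m q (L x0)) (l x0)))) (at x0)"
proof -
  define P R where "P = I2 m q (L x0)" and "R = I3 m q (L x0)"
  \<comment> \<open>Isospectrality: all paths of the family lie on one and the same curve.\<close>
  have PR: "I2 m q (L x) = P" "I3 m q (L x) = R" if "x \<in> T" for x
    unfolding P_def R_def
    by (intro poly_eq_poly_eq_iff[THEN iffD1] ext constant_on_connected_open[OF T _ that x0] isospectral_I2[OF flow]
      isospectral_I3[OF flow]; assumption)+
  have curve: "p x t \<in> regular_curve P R" if "x \<in> T" "t \<in> {0..1}" for x t
  proof -
    have "p x t \<in> spectral_curve m q (L x)"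
      "3 * (fst (p x t))^2 - poly (I2 m q (L x)) (snd (p x t)) \<noteq> 0"
      using p that unfolding path_family_def by blast+
    then show ?thesis
      unfolding PR[OF that(1)] regular_curve_def spectral_curve_def case_prod_unfold
      using PR[OF that(1)] by simp
  qed
  have integral: "abelian_integral m q (L x) g (p x) = integral {0..1} (curve_integrand P g (p x))"
    if "x \<in> T" for x
    unfolding abelian_integral_def curve_integrand_def PR[OF that] ..
  have p1: "p x 1 = (wval m q (L x) (l x), l x)" if "x \<in> T" for x
    using p that by (simp add: path_family_def)
  have c1: "p x0 1 \<in> regular_curve P R"
    using curve[OF x0] by simp
  have cont: "continuous_on (T \<times> {0..1}) (\<lambda>(x, t). p x t)"
    and vp: "\<And>x. x \<in> T \<Longrightarrow> valid_path (\<lambda>t. snd (p x t))"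
    and base: "\<And>x. x \<in> T \<Longrightarrow> p x 0 = b"
    using p by (simp_all add: path_family_def)
  obtain U F where F: "local_primitive P R g U F" "p x0 1 \<in> U"
    using local_primitive_exists[where g = g, OF c1 g] by blast
  have "eventually (\<lambda>x. integral {0..1} (curve_integrand P g (p x)) -
            integral {0..1} (curve_integrand P g (p x0)) =
            F (snd (p x 1)) - F (snd (p x0 1))) (nhds x0)"
    by (rule curve_integral_endpoint[OF cont T(1) x0 vp base curve g F])
  \<comment> \<open>Near \<open>x0\<close> the integral is \<open>F (l x)\<close> plus a constant,
    so the chain rule gives its derivative.\<close>
  then have ev: "eventually (\<lambda>x. F (l x) + (abelian_integral m q (L x0) g (p x0) - F (l x0)) =
      abelian_integral m q (L x) g (p x)) (nhds x0)"
    using eventually_nhds_in_open[OF T(1) x0]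
  proof eventually_elim
    case (elim x)
    then show ?case
      by (simp add: p1 integral x0) (simp add: algebra_simps)
  qed
  have "(F has_field_derivative g (wval m q (L x0) (l x0)) (l x0) /
      (3 * (wval m q (L x0) (l x0))^2 - poly P (l x0))) (at (l x0))"
    using F c1 unfolding p1[OF x0] local_primitive_def by blast
  from field_vector_diff_chain_at[OF l this]
  have "((\<lambda>x. F (l x) + (abelian_integral m q (L x0) g (p x0) - F (l x0))) has_vector_derivative
     D * (g (wval m q (L x0) (l x0)) (l x0) /
      (3 * (wval m q (L x0) (l x0))^2 - poly P (l x0))) + 0) (at x0)"
    unfolding o_def by (intro derivative_intros)
  then have "((\<lambda>x. abelian_integral m q (L x) g (p x)) has_vector_derivative
     D * (g (wval m q (L x0) (l x0)) (l x0) /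
      (3 * (wval m q (L x0) (l x0))^2 - poly P (l x0))) + 0) (at x0)"
    by (rule iffD1[OF has_vector_derivative_cong_ev, rotated 2])
      (use ev in \<open>auto elim: eventually_mono\<close>)
  then show ?thesis
    by (simp only: P_def add_0_right)
qed

text \<open>The factor \<open>3w^2 - I2\<close> in the velocity of each root cancels the denominator
  of the differential. The numerator that remains is, up to sign, the determinant of
  \<open>What\<close> with its first column replaced by \<open>\<rho>\<close>.\<close>

lemma abelian_sum_has_vector_derivative:
  assumes nz: "m \<noteq> 0" "m^2 \<noteq> 9 * q^2" and T: "open T" "connected T"
    and flow: "stationary_flow m q T L"
    and lam_cont: "\<And>k. continuous_on T (lam k)"
    and gen: "\<And>x. x \<in> T \<Longrightarrow> generic m q (L x) (\<lambda>k. lam k x)"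
    and x: "x \<in> T" and P: "\<And>k. path_family m q T L (lam k) (w0 k, l0) (P k)"
    and g: "\<And>A W. open A \<Longrightarrow> W holomorphic_on A \<Longrightarrow> (\<lambda>z. g (W z) z) holomorphic_on A"
  defines "\<rho> \<equiv> \<lambda>k. g (wval m q (L x) (lam k x)) (lam k x)"
  shows "(abelian_sum m q L g P has_vector_derivative
     - (\<rho> 1 * (lam 2 x - lam 3 x) + \<rho> 2 * (lam 3 x - lam 1 x) + \<rho> 3 * (lam 1 x - lam 2 x))
       / det (What m q (L x) (\<lambda>k. lam k x))) (at x)"
proof -
  define W where "W = det (What m q (L x) (\<lambda>k. lam k x))"
  have d: "((\<lambda>y. abelian_integral m q (L y) g (P k y)) has_vector_derivative
      - (\<rho> k * (lam i x - lam j x)) / W) (at x)"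
    if "(k, i, j) \<in> {(1, 2, 3), (2, 3, 1), (3, 1, 2 :: 3)}" for k i j
  proof -
    define G where "G = 3 * (wval m q (L x) (lam k x))^2 - poly (I2 m q (L x)) (lam k x)"
    have "G \<noteq> 0"
      using gen[OF x] by (simp add: generic_def G_def)
    have "(lam k has_vector_derivative - (G * (lam i x - lam j x)) / W) (at x)"
      unfolding G_def W_def by (rule dubrovin_equation[OF nz T(1) flow lam_cont gen x that])
    then have "((\<lambda>y. abelian_integral m q (L y) g (P k y)) has_vector_derivative
        - (G * (lam i x - lam j x)) / W * (\<rho> k / G)) (at x)"
      unfolding G_def \<rho>_def by (rule abelian_integral_has_vector_derivative[OF T flow x P _ g])
    also have "- (G * (lam i x - lam j x)) / W * (\<rho> k / G) = - (\<rho> k * (lam i x - lam j x)) / W"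
      using \<open>G \<noteq> 0\<close> by simp
    finally show ?thesis .
  qed
  have "((\<lambda>y. abelian_integral m q (L y) g (P 1 y) + abelian_integral m q (L y) g (P 2 y)
        + abelian_integral m q (L y) g (P 3 y)) has_vector_derivative
      - (\<rho> 1 * (lam 2 x - lam 3 x)) / W + - (\<rho> 2 * (lam 3 x - lam 1 x)) / W
        + - (\<rho> 3 * (lam 1 x - lam 2 x)) / W) (at x)"
    by (intro derivative_intros d) auto
  then show ?thesis
    unfolding W_def[symmetric] abelian_sum_def[abs_def] sum_3
    by (simp add: add_divide_distrib diff_divide_distrib)
qed

theorem mainTheorem3:
  fixes m q :: complex and T :: "real set" and L :: "real \<Rightarrow> cmat"
    and lam :: "3 \<Rightarrow> real \<Rightarrow> complex"
  assumes m_nz: "m \<noteq> 0" and mq: "m^2 \<noteq> 9 * q^2"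
    and T: "open T" "connected T"
    and flow: "stationary_flow m q T L"
    and lam_cont: "\<And>k. continuous_on T (lam k)"
    and gen: "\<And>x. x \<in> T \<Longrightarrow> generic m q (L x) (\<lambda>k. lam k x)"
  shows
    "(\<forall>x\<in>T. \<forall>(k, i, j)\<in>{(1, 2, 3), (2, 3, 1), (3, 1, 2)}.
        (lam k has_vector_derivative
           - ((3 * (wval m q (L x) (lam k x))^2 - poly (I2 m q (L x)) (lam k x))
                * (lam i x - lam j x))
             / det (What m q (L x) (\<lambda>k. lam k x))) (at x))
   \<and> (\<forall>w0 l0 P. (\<forall>k. path_family m q T L (lam k) (w0 k, l0) (P k)) \<longrightarrow>
        (let \<phi>1 = abelian_sum m q L (\<lambda>w z. 1) P;
             \<phi>2 = abelian_sum m q L (\<lambda>w z. z) P;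
             \<phi>3 = abelian_sum m q L (\<lambda>w z. w) P
         in (\<forall>x\<in>T. (\<phi>1 has_vector_derivative 0) (at x) \<and>
                   (\<phi>2 has_vector_derivative 0) (at x) \<and>
                   (\<phi>3 has_vector_derivative -1) (at x)) \<and>
            (\<exists>C1 C2 C3. \<forall>x\<in>T. \<phi>1 x = C1 \<and> \<phi>2 x = C2 \<and>
                               \<phi>3 x = C3 - complex_of_real x)))"
proof (intro conjI ballI allI impI)
  fix x and t :: "3 \<times> 3 \<times> 3" assume x: "x \<in> T" and t: "t \<in> {(1, 2, 3), (2, 3, 1), (3, 1, 2)}"
  obtain k i j where [simp]: "t = (k, i, j)"
    by (cases t)
  show "case t of (k, i, j) \<Rightarrow> (lam k has_vector_derivative
           - ((3 * (wval m q (L x) (lam k x))^2 - poly (I2 m q (L x)) (lam k x))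
                * (lam i x - lam j x))
             / det (What m q (L x) (\<lambda>k. lam k x))) (at x)"
    using dubrovin_equation[OF m_nz mq T(1) flow lam_cont gen x, of k i j] t by simp
next
  fix w0 :: "3 \<Rightarrow> complex" and l0 P
  assume "\<forall>k. path_family m q T L (lam k) (w0 k, l0) (P k)"
  then have P: "path_family m q T L (lam k) (w0 k, l0) (P k)" for k
    by blast
  define \<phi>1 where "\<phi>1 = abelian_sum m q L (\<lambda>w z. 1) P"
  define \<phi>2 where "\<phi>2 = abelian_sum m q L (\<lambda>w z. z) P"
  define \<phi>3 where "\<phi>3 = abelian_sum m q L (\<lambda>w z. w) P"
  have d: "(abelian_sum m q L g P has_vector_derivative
     - (\<rho> 1 * (lam 2 x - lam 3 x) + \<rho> 2 * (lam 3 x - lam 1 x) + \<rho> 3 * (lam 1 x - lam 2 x))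
       / det (What m q (L x) (\<lambda>k. lam k x))) (at x)"
    if x: "x \<in> T"
      and g: "\<And>A W. open A \<Longrightarrow> W holomorphic_on A \<Longrightarrow> (\<lambda>z. g (W z) z) holomorphic_on A"
      and "\<rho> = (\<lambda>k. g (wval m q (L x) (lam k x)) (lam k x))" for g x \<rho>
    unfolding that(3)
    by (rule abelian_sum_has_vector_derivative[OF m_nz mq T flow lam_cont gen x P g])
  \<comment> \<open>For \<open>g\<close> equal to 1 or \<open>z\<close> the replaced column repeats
    another one, so the determinant is 0; for \<open>g\<close> equal to \<open>w\<close> it is the
    determinant of \<open>What\<close> itself and the quotient is -1.\<close>
  have d1: "(\<phi>1 has_vector_derivative 0) (at x)" if "x \<in> T" for x
    using d[OF that, of "\<lambda>w z. 1", OF _ refl] by (simp add: \<phi>1_def)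
  have d2: "(\<phi>2 has_vector_derivative 0) (at x)" if "x \<in> T" for x
    using d[OF that, of "\<lambda>w z. z", OF _ refl] by (simp add: \<phi>2_def algebra_simps)
  have d3: "(\<phi>3 has_vector_derivative -1) (at x)" if "x \<in> T" for x
  proof -
    have "det (What m q (L x) (\<lambda>k. lam k x)) \<noteq> 0"
      using gen[OF that] by (simp add: generic_def)
    then show ?thesis
      using d[OF that, of "\<lambda>w z. w", OF _ refl]
      unfolding \<phi>3_def det_What[of m q "L x" "\<lambda>k. lam k x", symmetric] by simp
  qed
  have d3': "((\<lambda>x. \<phi>3 x + complex_of_real x) has_vector_derivative 0) (at x)" if "x \<in> T" for x
    using has_vector_derivative_add[OF d3[OF that] has_vector_derivative_of_real[OF DERIV_ident]]
    by simp
  have "\<exists>C. \<forall>x\<in>T. f x = C" if "\<And>x. x \<in> T \<Longrightarrow> (f has_vector_derivative 0) (at x)"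
    for f :: "real \<Rightarrow> complex"
    using constant_on_connected_open[OF T that] by blast
  from this[OF d1] this[OF d2] this[OF d3']
  obtain C1 C2 C3 where "\<forall>x\<in>T. \<phi>1 x = C1" "\<forall>x\<in>T. \<phi>2 x = C2" "\<forall>x\<in>T. \<phi>3 x + complex_of_real x = C3"
    by blast
  then have "\<exists>C1 C2 C3. \<forall>x\<in>T. \<phi>1 x = C1 \<and> \<phi>2 x = C2 \<and> \<phi>3 x = C3 - complex_of_real x"
    by (metis add_diff_cancel_right')
  with d1 d2 d3 show "let \<phi>1 = abelian_sum m q L (\<lambda>w z. 1) P;
             \<phi>2 = abelian_sum m q L (\<lambda>w z. z) P;
             \<phi>3 = abelian_sum m q L (\<lambda>w z. w) P
         in (\<forall>x\<in>T. (\<phi>1 has_vector_derivative 0) (at x) \<and>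
                   (\<phi>2 has_vector_derivative 0) (at x) \<and>
                   (\<phi>3 has_vector_derivative -1) (at x)) \<and>
            (\<exists>C1 C2 C3. \<forall>x\<in>T. \<phi>1 x = C1 \<and> \<phi>2 x = C2 \<and>
                               \<phi>3 x = C3 - complex_of_real x)"
    unfolding Let_def \<phi>1_def[symmetric] \<phi>2_def[symmetric] \<phi>3_def[symmetric] by blast
qed

end
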